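(* Let $T^2=(\mathbb R/2\pi\mathbb Z)^2$ be the flat torus with coordinates $(\theta,\varphi)$, let $\tau(\theta,\varphi)=(\theta+\pi,-\varphi)$, and let $K^2=T^2/\tau$ be the Klein bottle, with projection $\pi:T^2\to K^2$. For each sign $\pm$ consider the four pin$^\pm$ structures $\tilde\xi_0,\tilde\xi_1,\tilde\xi_2,\tilde\xi_3: T^2\times\mathrm{Pin}^\pm(2)\to T^2\times O(2)\cong P_OT^2$ given by $$\tilde\xi_0(\theta,\varphi,p')=(\theta,\varphi,p),\quad \tilde\xi_1(\theta,\varphi,p')=(\theta,\varphi,R_\theta p),$$ $$\tilde\xi_2(\theta,\varphi,p')=(\theta,\varphi,R_\varphi p),\quad \tilde\xi_3(\theta,\varphi,p')=(\theta,\varphi,R_\varphi R_\theta p),$$ where $p=p^\pm(p')$ and $R_x\in SO(2)$ is the rotation by the angle $x$. Then all four are $\tau$-invariant. For $\tilde\xi_0$ and $\tilde\xi_2$ the lifts $\widetilde{d\tau}$ of $d\tau$ satisfy $\widetilde{d\tau}^2=\mathrm{id}$ in the pin$^+$ case and $\widetilde{d\tau}^2=\gamma$ in the pin$^-$ case, while for $\tilde\xi_1$ and $\tilde\xi_3$ they satisfy $\widetilde{d\tau}^2=\gamma$ in the pin$^+$ case and $\widetilde{d\tau}^2=\mathrm{id}$ in the pin$^-$ case. Consequently, among these structures exactly $\tilde\xi_0,\tilde\xi_2$ (pin$^+$ case), respectively exactly $\tilde\xi_1,\tilde\xi_3$ (pin$^-$ case), are equivalent to pull-backs of pin$^\pm$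 structures on $K^2$; in particular the pull-back map from pin$^\pm$ structures on $K^2$ to $\tau$-invariant pin$^\pm$ structures on $T^2$ is not surjective.
   Context: $\mathrm{Pin}^{+}(m)$ and $\mathrm{Pin}^-(m)$ are the two double coverings $p^\pm:\mathrm{Pin}^\pm(m)\to O(m)$ with kernel $\{\pm1\}$ built from the Clifford algebras in which unit vectors $v$ satisfy $v^2=+1$, resp. $v^2=-1$; a unit vector $v$ covers the reflection in $v^\perp$. For a Riemannian manifold $M$ of dimension $m$, $P_OM$ is its orthonormal frame bundle. A pin$^\pm$ structure on $M$ is a principal $\mathrm{Pin}^\pm(m)$-bundle $P_{\mathrm{Pin}^\pm}M\to M$ with a 2-covering $\xi:P_{\mathrm{Pin}^\pm}M\to P_OM$ over $M$ satisfying $\xi(p\cdot s)=\xi(p)\cdot p^\pm(s)$. Two pin$^\pm$ structures $\xi,\xi'$ are equivalent if there is a principal bundle isomorphism $\rho$ with $\xi'\circ\rho=\xi$. $\gamma$ denotes the exchange of the two sheets of $\xi$, i.e. the action of $-1\in\mathrm{Pin}^\pm(m)$. For an isometry $\varphi$ of $M$, $\xi$ is $\varphi$-invariant if there is a $\mathrm{Pin}^\pm(m)$-equivariant diffeomorphism $\widetilde{d\varphi}$ of $P_{\mathrm{Pin}^\pm}M$ (a lift of $d\varphi$) with $\xi\circ\widetilde{d\varphi}=d\varphi\circ\xi$. For $M$ connected there are then exactly two lifts, $\widetilde{d\varphi}$ and $\widetilde{d\varphi}\circ\gamma$; if $\varphi^2=\mathrm{id}$ both have the same square, which is $\mathrm{id}$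 or $\gamma$. The identification $P_OT^2\cong T^2\times O(2)$ uses the coordinate frame $(\partial_\theta,\partial_\varphi)=(e_1,e_2)$; in it $d\tau(\theta,\varphi,p)=(\theta+\pi,-\varphi,j_2p)$ with $j_2=\mathrm{diag}(1,-1)$, and the structure groups act by right multiplication on the last factor. $K^2$ carries the induced flat metric. The pull-back of a pin$^\pm$ structure $P\to P_OK^2$ is $\pi^*P\to\pi^*P_OK^2\cong P_OT^2$, where the last isomorphism is inverse to $f\mapsto(d\pi(f),\text{base point of }f)$. *)

theory Defs
  imports "HOL-Analysis.Analysis" "HOL-Algebra.Group"
begin

section \<open>The groups Pin(2) and their coverings of O(2)\<close>

text \<open>
  The Clifford algebra of the Euclidean plane in which unit vectors square to
  \<open>e\<close> (the pin-plus case is \<open>e = 1\<close>, the pin-minus case is \<open>e = -1\<close>).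
  The tuple \<open>(a, b, c, d)\<close> stands for \<open>a + b e1 + c e2 + d e1 e2\<close>, where
  \<open>e1 e1 = e2 e2 = e\<close> and \<open>e2 e1 = - e1 e2\<close>; hence \<open>(e1 e2) (e1 e2) = - e * e = -1\<close>.
\<close>

type_synonym cl2 = "real \<times> real \<times> real \<times> real"

fun cl_mult :: "real \<Rightarrow> cl2 \<Rightarrow> cl2 \<Rightarrow> cl2" where
  "cl_mult e (a, b, c, d) (a', b', c', d') =
     (a * a' + e * (b * b' + c * c') - d * d',
      a * b' + b * a' + e * (d * c' - c * d'),
      a * c' + c * a' + e * (b * d' - d * b'),
      a * d' + d * a' + b * c' - c * b')"

definition cl_one :: cl2 where
  "cl_one = (1, 0, 0, 0)"

definition cl_vec :: "real^2 \<Rightarrow> cl2" where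
  "cl_vec v = (0, v $ 1, v $ 2, 0)"

fun cl_vec_part :: "cl2 \<Rightarrow> real^2" where
  "cl_vec_part (a, b, c, d) = vector [b, c]"

fun cl_grade :: "cl2 \<Rightarrow> cl2" where
  "cl_grade (a, b, c, d) = (a, - b, - c, d)"

text \<open>The subgroup of the units generated by the unit vectors; the inverse of
  a unit vector \<open>v\<close> is the unit vector \<open>e v\<close>.\<close>

inductive_set pin_set :: "real \<Rightarrow> cl2 set" for e :: real where
  one: "cl_one \<in> pin_set e"
| step: "s \<in> pin_set e \<Longrightarrow> norm v = 1 \<Longrightarrow> cl_mult e s (cl_vec v) \<in> pin_set e"

definition pin_group :: "real \<Rightarrow> cl2 monoid" where
  "pin_group e = \<lparr>carrier = pin_set e, mult = cl_mult e, one = cl_one\<rparr>"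

text \<open>The twisted adjoint action of \<open>s\<close> on vectors, \<open>v \<mapsto> \<alpha>(s) v s\<^sup>-\<^sup>1\<close> with \<open>\<alpha>\<close> the
  grading automorphism. For a unit vector \<open>s\<close> this is the reflection in the line orthogonal
  to \<open>s\<close>, for either sign.\<close>

definition pin_cover :: "real \<Rightarrow> cl2 \<Rightarrow> real^2^2" where
  "pin_cover e s = matrix (\<lambda>v. cl_vec_part
     (cl_mult e (cl_mult e (cl_grade s) (cl_vec v)) (inv\<^bsub>pin_group e\<^esub> s)))"


section \<open>The torus\<close>

definition angle_rel :: "real \<Rightarrow> real \<Rightarrow> bool" where
  "angle_rel x y \<longleftrightarrow> (\<exists>k::int. x - y = 2 * pi * of_int k)"

lemma equivp_angle_rel: "equivp angle_rel"
proof (rule equivpI)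
  show "reflp angle_rel"
    unfolding reflp_def angle_rel_def by (auto intro!: exI[of _ 0])
  show "symp angle_rel"
    unfolding symp_def angle_rel_def
  proof (intro allI impI)
    fix x y :: real assume "\<exists>k::int. x - y = 2 * pi * of_int k"
    then obtain k :: int where "x - y = 2 * pi * of_int k" by blast
    then have "y - x = 2 * pi * of_int (- k)" by simp
    then show "\<exists>k::int. y - x = 2 * pi * of_int k" by blast
  qed
  show "transp angle_rel"
    unfolding transp_def angle_rel_def
  proof (intro allI impI)
    fix x y z :: real
    assume "\<exists>k::int. x - y = 2 * pi * of_int k" "\<exists>k::int. y - z = 2 * pi * of_int k"
    then obtain k l :: int where "x - y = 2 * pi * of_int k" "y - z = 2 * pi * of_int l" by blast
    then have "x - z = 2 * pi * of_int (k + l)" by (simp add: algebra_simps)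
    then show "\<exists>k::int. x - z = 2 * pi * of_int k" by blast
  qed
qed

quotient_type angle = real / angle_rel
  morphisms rep_angle angle
  by (rule equivp_angle_rel)

instantiation angle :: ab_group_add
begin

lift_definition zero_angle :: angle is "0 :: real" .

lift_definition plus_angle :: "angle \<Rightarrow> angle \<Rightarrow> angle" is "(+) :: real \<Rightarrow> real \<Rightarrow> real"
proof -
  fix a b c d :: real
  assume "angle_rel a b" "angle_rel c d"
  then obtain k l :: int where "a - b = 2 * pi * of_int k" "c - d = 2 * pi * of_int l"
    unfolding angle_rel_def by blast
  then have "(a + c) - (b + d) = 2 * pi * of_int (k + l)" by (simp add: algebra_simps)
  then show "angle_rel (a + c) (b + d)" unfolding angle_rel_def by blast
qed

lift_definition uminus_angle :: "angle \<Rightarrow> angle" is "uminus :: real \<Rightarrow> real"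
proof -
  fix a b :: real
  assume "angle_rel a b"
  then obtain k :: int where "a - b = 2 * pi * of_int k"
    unfolding angle_rel_def by blast
  then have "(- a) - (- b) = 2 * pi * of_int (- k)" by simp
  then show "angle_rel (- a) (- b)" unfolding angle_rel_def by blast
qed

definition minus_angle :: "angle \<Rightarrow> angle \<Rightarrow> angle" where
  "minus_angle x y = x + - y"

instance
proof
  fix a b c :: angle
  show "a + b + c = a + (b + c)"
    by transfer (auto simp: angle_rel_def add.assoc intro!: exI[of _ 0])
  show "a + b = b + a"
    by transfer (auto simp: angle_rel_def add.commute intro!: exI[of _ 0])
  show "0 + a = a"
    by transfer (auto simp: angle_rel_def intro!: exI[of _ 0])
  show "- a + a = 0"
    by transfer (auto simp: angle_rel_def intro!: exI[of _ 0])
  show "a - b = a + - b"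
    by (rule minus_angle_def)
qed

end

text \<open>Quotient topology.\<close>

instantiation angle :: topological_space
begin

definition open_angle :: "angle set \<Rightarrow> bool" where
  "open_angle U \<longleftrightarrow> open (angle -` U)"

instance
  by standard (auto simp: open_angle_def vimage_Union intro!: open_UN)

end

type_synonym torus = "angle \<times> angle"

lift_definition rot :: "angle \<Rightarrow> real^2^2" is
  "\<lambda>x. vector [vector [cos x, - sin x], vector [sin x, cos x]]"
proof -
  fix x y :: real
  assume "angle_rel x y"
  then obtain k :: int where "x = y + 2 * pi * of_int k"
    unfolding angle_rel_def by (metis add.commute diff_add_cancel)
  then have "cos x = cos y" "sin x = sin y"
    by (simp_all add: cos_add sin_add cos_int_2pin sin_int_2pin)
  then show "(vector [vector [cos x, - sin x], vector [sin x, cos x]] :: real^2^2) =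
             vector [vector [cos y, - sin y], vector [sin y, cos y]]" by simp
qed

definition j2 :: "real^2^2" where
  "j2 = vector [vector [1, 0], vector [0, - 1]]"

definition tau :: "torus \<Rightarrow> torus" where
  "tau = (\<lambda>(\<theta>, \<phi>). (\<theta> + angle pi, - \<phi>))"

text \<open>An element \<open>(x, A)\<close> is the pair of tangent vectors at \<open>x\<close> whose components with respect
  to the coordinate frame are the columns of \<open>A\<close>; it is an orthonormal frame iff \<open>A\<close> is
  orthogonal.\<close>

type_synonym tpair = "torus \<times> (real^2^2)"

definition dtau :: "tpair \<Rightarrow> tpair" where
  "dtau = (\<lambda>(x, A). (tau x, j2 ** A))"

lemma tau_tau: "tau (tau x) = x"
proof -
  have *: "angle pi + angle pi = 0"
    by transfer (auto simp: angle_rel_def intro!: exI[of _ 1])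
  show ?thesis
    by (cases x) (simp add: tau_def add.assoc *)
qed

lemma j2_j2: "j2 ** j2 = mat 1"
  by (simp add: j2_def matrix_matrix_mult_def mat_def vec_eq_iff forall_2 sum_2)

lemma dtau_dtau: "dtau (dtau f) = f"
  by (cases f) (simp add: dtau_def tau_tau matrix_mul_assoc j2_j2)


section \<open>The Klein bottle\<close>

definition klein_rel :: "torus \<Rightarrow> torus \<Rightarrow> bool" where
  "klein_rel x y \<longleftrightarrow> y = x \<or> y = tau x"

lemma equivp_klein_rel: "equivp klein_rel"
  by (rule equivpI) (auto simp: reflp_def symp_def transp_def klein_rel_def tau_tau)

quotient_type klein = torus / klein_rel
  morphisms rep_klein klein_pi
  by (rule equivp_klein_rel)

instantiation klein :: topological_space
begin

definition open_klein :: "klein set \<Rightarrow> bool" where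
  "open_klein U \<longleftrightarrow> open (klein_pi -` U)"

instance
  by standard (auto simp: open_klein_def vimage_Union intro!: open_UN)

end

text \<open>Pairs of tangent vectors of the Klein bottle at a common point. The tangent bundle of the
  quotient by the free isometric involution \<open>tau\<close> is the quotient of the tangent bundle of the
  torus by the differential of \<open>tau\<close>.\<close>

definition kpair_rel :: "tpair \<Rightarrow> tpair \<Rightarrow> bool" where
  "kpair_rel f g \<longleftrightarrow> g = f \<or> g = dtau f"

lemma equivp_kpair_rel: "equivp kpair_rel"
  by (rule equivpI) (auto simp: reflp_def symp_def transp_def kpair_rel_def dtau_dtau)

quotient_type kpair = tpair / kpair_rel
  morphisms rep_kpair dpi
  by (rule equivp_kpair_rel)

instantiation kpair :: topological_space
begin

definition open_kpair :: "kpair set \<Rightarrow> bool" where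
  "open_kpair U \<longleftrightarrow> open (dpi -` U)"

instance
  by standard (auto simp: open_kpair_def vimage_Union intro!: open_UN)

end

lift_definition kpair_base :: "kpair \<Rightarrow> klein" is "fst :: tpair \<Rightarrow> torus"
  by (auto simp: kpair_rel_def klein_rel_def dtau_def)

text \<open>Orthonormality is with respect to the induced metric, for which the projection is a
  local isometry.\<close>

lift_definition kpair_orthonormal :: "kpair \<Rightarrow> bool" is
  "\<lambda>(x, A). orthogonal_matrix A"
proof -
  have j2: "orthogonal_matrix j2"
    by (simp add: orthogonal_matrix j2_def transpose_def matrix_matrix_mult_def mat_def
        vec_eq_iff forall_2 sum_2)
  have "orthogonal_matrix (j2 ** A) \<longleftrightarrow> orthogonal_matrix A" for A :: "real^2^2"
    by (metis j2 j2_j2 matrix_mul_assoc matrix_mul_lid orthogonal_matrix_mul)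
  then show "\<And>f g. kpair_rel f g \<Longrightarrow>
      (case f of (x, A) \<Rightarrow> orthogonal_matrix A) = (case g of (x, A) \<Rightarrow> orthogonal_matrix A)"
    by (auto simp: kpair_rel_def dtau_def)
qed

lift_definition kpair_act :: "kpair \<Rightarrow> real^2^2 \<Rightarrow> kpair" is
  "\<lambda>(x, A) B. (x, A ** B)"
  by (auto simp: kpair_rel_def dtau_def matrix_mul_assoc)


section \<open>Frame bundles and pin structures\<close>

record ('b, 'f) frame_bundle =
  frames :: "'f topology"
  frame_base :: "'f \<Rightarrow> 'b"
  frame_act :: "'f \<Rightarrow> real^2^2 \<Rightarrow> 'f"

definition frames_T2 :: "(torus, tpair) frame_bundle" where
  "frames_T2 = \<lparr>frames = prod_topology euclidean (top_of_set {A. orthogonal_matrix A}),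
     frame_base = fst, frame_act = (\<lambda>(x, A) B. (x, A ** B))\<rparr>"

definition frames_K2 :: "(klein, kpair) frame_bundle" where
  "frames_K2 = \<lparr>frames = top_of_set {f. kpair_orthonormal f},
     frame_base = kpair_base, frame_act = kpair_act\<rparr>"

text \<open>Principal bundle with structure group \<open>G\<close>, topologized as a subspace of its type, over the
  whole base space. The total space \<open>P\<close> is an abstract topology; conditions concern its points
  and the carrier of \<open>G\<close> only.\<close>

definition principal_bundle ::
    "('g::topological_space, 'r) monoid_scheme \<Rightarrow> 'p topology \<Rightarrow> ('p \<Rightarrow> 'g \<Rightarrow> 'p)
      \<Rightarrow> ('p \<Rightarrow> 'b::topological_space) \<Rightarrow> bool" where
  "principal_bundle G P act pr \<longleftrightarrow>
     continuous_map (prod_topology P (top_of_set (carrier G))) P (\<lambda>(p, g). act p g) \<and>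
     (\<forall>p\<in>topspace P. act p \<one>\<^bsub>G\<^esub> = p) \<and>
     (\<forall>p\<in>topspace P. \<forall>g\<in>carrier G. \<forall>h\<in>carrier G. act p (g \<otimes>\<^bsub>G\<^esub> h) = act (act p g) h) \<and>
     continuous_map P euclidean pr \<and>
     (\<forall>p\<in>topspace P. \<forall>g\<in>carrier G. pr (act p g) = pr p) \<and>
     (\<forall>b. \<exists>U \<Phi>. open U \<and> b \<in> U \<and>
        homeomorphic_map (prod_topology (top_of_set U) (top_of_set (carrier G)))
          (subtopology P {p \<in> topspace P. pr p \<in> U}) \<Phi> \<and>
        (\<forall>x\<in>U. \<forall>g\<in>carrier G. pr (\<Phi> (x, g)) = x) \<and>
        (\<forall>x\<in>U. \<forall>g\<in>carrier G. \<forall>h\<in>carrier G. \<Phi> (x, g \<otimes>\<^bsub>G\<^esub> h) = act (\<Phi> (x, g)) h))"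

definition two_fold_covering :: "'p topology \<Rightarrow> 'f topology \<Rightarrow> ('p \<Rightarrow> 'f) \<Rightarrow> bool" where
  "two_fold_covering P F c \<longleftrightarrow> continuous_map P F c \<and>
     (\<forall>f\<in>topspace F. \<exists>V \<U>. openin F V \<and> f \<in> V \<and>
        card \<U> = 2 \<and> pairwise disjnt \<U> \<and> \<Union>\<U> = {p \<in> topspace P. c p \<in> V} \<and>
        (\<forall>U\<in>\<U>. openin P U \<and> homeomorphic_map (subtopology P U) (subtopology F V) c))"

record ('p, 'b, 'f) pin_bundle =
  pin_total :: "'p topology"
  pin_act :: "'p \<Rightarrow> cl2 \<Rightarrow> 'p"
  pin_base :: "'p \<Rightarrow> 'b"
  pin_xi :: "'p \<Rightarrow> 'f"

text \<open>The total space carries the smooth structure pulled back along the covering \<open>pin_xi\<close>, the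
  only one for which \<open>pin_xi\<close> is a local diffeomorphism; so it is not a separate datum.\<close>

definition pin_structure ::
    "real \<Rightarrow> ('b::topological_space, 'f) frame_bundle \<Rightarrow> ('p, 'b, 'f) pin_bundle \<Rightarrow> bool" where
  "pin_structure e F S \<longleftrightarrow>
     principal_bundle (pin_group e) (pin_total S) (pin_act S) (pin_base S) \<and>
     two_fold_covering (pin_total S) (frames F) (pin_xi S) \<and>
     (\<forall>p\<in>topspace (pin_total S). frame_base F (pin_xi S p) = pin_base S p) \<and>
     (\<forall>p\<in>topspace (pin_total S). \<forall>s\<in>pin_set e.
        pin_xi S (pin_act S p s) = frame_act F (pin_xi S p) (pin_cover e s))"


section \<open>Smooth maps\<close>

primrec Ck_on :: "nat \<Rightarrow> ('a::euclidean_space \<Rightarrow> 'b::euclidean_space) \<Rightarrow> 'a set \<Rightarrow> bool" where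
  "Ck_on 0 f N \<longleftrightarrow> continuous_on N f"
| "Ck_on (Suc k) f N \<longleftrightarrow> (\<exists>f'. (\<forall>x\<in>N. (f has_derivative f' x) (at x)) \<and>
     (\<forall>v. Ck_on k (\<lambda>x. f' x v) N))"

definition smooth_on :: "('a::euclidean_space \<Rightarrow> 'b::euclidean_space) \<Rightarrow> 'a set \<Rightarrow> bool" where
  "smooth_on f N \<longleftrightarrow> (\<forall>k. Ck_on k f N)"

definition unroll :: "(real \<times> real) \<times> (real^2^2) \<Rightarrow> tpair" where
  "unroll = (\<lambda>((a, b), A). ((angle a, angle b), A))"

text \<open>Smoothness of a map from an open set \<open>W\<close> of orthonormal frames of the torus to frames
  of the torus: locally it lifts to the universal cover of the torus and extends to a smooth map
  of the ambient Euclidean space.\<close>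

definition smooth_frame_map :: "tpair set \<Rightarrow> (tpair \<Rightarrow> tpair) \<Rightarrow> bool" where
  "smooth_frame_map W F \<longleftrightarrow> (\<forall>z. unroll z \<in> W \<longrightarrow>
     (\<exists>N G. open N \<and> z \<in> N \<and> smooth_on G N \<and>
        (\<forall>y\<in>N. unroll y \<in> W \<longrightarrow> F (unroll y) = unroll (G y))))"

text \<open>Smoothness of a map between total spaces of pin structures on the torus, with the coverings
  themselves as local coordinates.\<close>

definition pin_smooth ::
    "('p, torus, tpair) pin_bundle \<Rightarrow> ('q, torus, tpair) pin_bundle \<Rightarrow> ('p \<Rightarrow> 'q) \<Rightarrow> bool" where
  "pin_smooth S S' f \<longleftrightarrow> continuous_map (pin_total S) (pin_total S') f \<and>
     (\<forall>p\<in>topspace (pin_total S). \<exists>U V. openin (pin_total S) U \<and> p \<in> U \<and>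
        openin (frames frames_T2) V \<and>
        homeomorphic_map (subtopology (pin_total S) U) (subtopology (frames frames_T2) V) (pin_xi S) \<and>
        smooth_frame_map V (pin_xi S' \<circ> f \<circ> inv_into U (pin_xi S)))"

definition pin_diffeo ::
    "('p, torus, tpair) pin_bundle \<Rightarrow> ('q, torus, tpair) pin_bundle \<Rightarrow> ('p \<Rightarrow> 'q) \<Rightarrow> bool" where
  "pin_diffeo S S' f \<longleftrightarrow> (\<exists>g. homeomorphic_maps (pin_total S) (pin_total S') f g \<and>
     pin_smooth S S' f \<and> pin_smooth S' S g)"


section \<open>Equivalence, lifts, invariance and pull-back\<close>

definition pin_equivariant ::
    "real \<Rightarrow> ('p, 'b, 'f) pin_bundle \<Rightarrow> ('q, 'c, 'h) pin_bundle \<Rightarrow> ('p \<Rightarrow> 'q) \<Rightarrow> bool" where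
  "pin_equivariant e S S' f \<longleftrightarrow> (\<forall>p\<in>topspace (pin_total S). \<forall>s\<in>pin_set e.
     f (pin_act S p s) = pin_act S' (f p) s)"

definition pin_equivalent ::
    "real \<Rightarrow> ('p, torus, tpair) pin_bundle \<Rightarrow> ('q, torus, tpair) pin_bundle \<Rightarrow> bool" where
  "pin_equivalent e S S' \<longleftrightarrow> (\<exists>\<rho>. pin_diffeo S S' \<rho> \<and> pin_equivariant e S S' \<rho> \<and>
     (\<forall>p\<in>topspace (pin_total S). pin_xi S' (\<rho> p) = pin_xi S p))"

definition is_lift ::
    "real \<Rightarrow> (tpair \<Rightarrow> tpair) \<Rightarrow> ('p, torus, tpair) pin_bundle \<Rightarrow> ('p \<Rightarrow> 'p) \<Rightarrow> bool" where
  "is_lift e df S L \<longleftrightarrow> pin_diffeo S S L \<and> pin_equivariant e S S L \<and>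
     (\<forall>p\<in>topspace (pin_total S). pin_xi S (L p) = df (pin_xi S p))"

definition tau_invariant :: "real \<Rightarrow> ('p, torus, tpair) pin_bundle \<Rightarrow> bool" where
  "tau_invariant e S \<longleftrightarrow> (\<exists>L. is_lift e dtau S L)"

definition sheet_exchange :: "('p, 'b, 'f) pin_bundle \<Rightarrow> 'p \<Rightarrow> 'p" where
  "sheet_exchange S p = pin_act S p (- cl_one)"

definition squares_to_id :: "('p, 'b, 'f) pin_bundle \<Rightarrow> ('p \<Rightarrow> 'p) \<Rightarrow> bool" where
  "squares_to_id S L \<longleftrightarrow> (\<forall>p\<in>topspace (pin_total S). L (L p) = p)"

definition squares_to_exchange :: "('p, 'b, 'f) pin_bundle \<Rightarrow> ('p \<Rightarrow> 'p) \<Rightarrow> bool" where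
  "squares_to_exchange S L \<longleftrightarrow> (\<forall>p\<in>topspace (pin_total S). L (L p) = sheet_exchange S p)"

definition pull_back ::
    "('p, klein, kpair) pin_bundle \<Rightarrow> (torus \<times> 'p, torus, tpair) pin_bundle" where
  "pull_back Q = \<lparr>
     pin_total = subtopology (prod_topology euclidean (pin_total Q)) {(x, q). klein_pi x = pin_base Q q},
     pin_act = (\<lambda>(x, q) s. (x, pin_act Q q s)),
     pin_base = fst,
     pin_xi = (\<lambda>(x, q). inv_into (topspace (frames frames_T2))
                 (\<lambda>f. (dpi f, frame_base frames_T2 f)) (pin_xi Q q, x))\<rparr>"


section \<open>The four pin structures on the torus\<close>

definition twisted_pin ::
    "real \<Rightarrow> (torus \<Rightarrow> real^2^2) \<Rightarrow> (torus \<times> cl2, torus, tpair) pin_bundle" where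
  "twisted_pin e R = \<lparr>
     pin_total = prod_topology euclidean (top_of_set (pin_set e)),
     pin_act = (\<lambda>(x, p) s. (x, cl_mult e p s)),
     pin_base = fst,
     pin_xi = (\<lambda>(x, p). (x, R x ** pin_cover e p))\<rparr>"

definition xi0 :: "real \<Rightarrow> (torus \<times> cl2, torus, tpair) pin_bundle" where
  "xi0 e = twisted_pin e (\<lambda>(\<theta>, \<phi>). mat 1)"

definition xi1 :: "real \<Rightarrow> (torus \<times> cl2, torus, tpair) pin_bundle" where
  "xi1 e = twisted_pin e (\<lambda>(\<theta>, \<phi>). rot \<theta>)"

definition xi2 :: "real \<Rightarrow> (torus \<times> cl2, torus, tpair) pin_bundle" where
  "xi2 e = twisted_pin e (\<lambda>(\<theta>, \<phi>). rot \<phi>)"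

definition xi3 :: "real \<Rightarrow> (torus \<times> cl2, torus, tpair) pin_bundle" where
  "xi3 e = twisted_pin e (\<lambda>(\<theta>, \<phi>). rot \<phi> ** rot \<theta>)"

end

(* A lift of dtau to the structure twisted by R has the form (x, p) |-> (tau x, q(x) p), where
   q(x) in Pin(2) covers R(tau x)^-1 j2 R(x). As the torus is connected, q is determined up to a
   global sign, so the square of a lift is the multiplication by q(tau x) q(x), whatever the lift.
   For R = 1 and R = R_phi one can take q = e2, and q(tau x) q(x) = e2 e2 = e. For the structures
   containing R_theta, the vector q = cos(theta) e1 - sin(theta) e2 does; it changes sign when theta
   is replaced by theta + pi, and so q(tau x) q(x) = - e.
   A pull-back carries the lift (x, y) |-> (tau x, y), whose square is the identity. Conversely, a
   structure with a lift of square one is the pull-back of its quotient by this lift.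
   In the coordinates given by the coverings, all bundle maps involved are the identity or dtau, so
   smoothness is automatic. *)

theory Submission
  imports Defs
begin

section \<open>The group Pin(2)\<close>

text \<open>The sign that separates the structures comes from R_(theta + pi) = - R_theta. It turns
  the matrix to be covered into - j2 R_(2 theta), a reflection whose mirror returns to itself when
  theta grows by pi, while its unit normal is reversed. A factor R_phi contributes nothing: R_(-phi)
  j2 = j2 R_phi, so it cancels. Both pin groups are treated at once, with \<open>e * e = 1\<close>.
  The obstacle is topological: pull-backs and quotients are described by choices
  (\<open>inv_into\<close>, \<open>the_elem\<close>), so continuity cannot be read off formulas. Two
  facts restore it. \<open>tau\<close> moves a band of width pi in theta off itself, so
  \<open>klein_pi\<close> is injective on the band and \<open>dpi\<close> on the frames over it.
  Projections by an involution are open, because the saturation of an open set is the union of the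
  set and its preimage under the involution. The coverings of the torus structures and of the
  quotients follow from one criterion: an open continuous surjection whose fibres are the orbits of
  an involution moving small sets off themselves. For pull-backs, evenly covered sets are pulled
  back directly.\<close>

lemma norm_real2_eq_1: "norm (v :: real^2) = 1 \<longleftrightarrow> (v $ 1)\<^sup>2 + (v $ 2)\<^sup>2 = 1"
  by (simp add: norm_vec_def L2_set_def sum_2)

lemma cl_mult_assoc:
  assumes "e * e = 1"
  shows "cl_mult e (cl_mult e s t) u = cl_mult e s (cl_mult e t u)"
proof -
  obtain a b c d a' b' c' d' a'' b'' c'' d''
    where s: "s = (a, b, c, d)" and t: "t = (a', b', c', d')" and u: "u = (a'', b'', c'', d'')"
    by (metis prod.collapse)
  have e: "e = 1 \<or> e = -1" using assms by (simp add: square_eq_1_iff)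
  then show ?thesis unfolding s t u by (elim disjE) (simp_all add: algebra_simps)
qed

lemma cl_mult_one [simp]: "cl_mult e cl_one s = s" "cl_mult e s cl_one = s"
  by (cases s; simp add: cl_one_def)+

lemma cl_mult_minus [simp]: "cl_mult e (- s) t = - cl_mult e s t" "cl_mult e s (- t) = - cl_mult e s t"
  by (cases s; cases t; simp add: algebra_simps)+

text \<open>Multiplication by a unit vector exchanges even and odd elements and preserves the
  Euclidean norm, so the group is the union of two circles; conversely two vectors suffice to reach
  any even element.\<close>

lemma pin_set_iff:
  assumes e: "e * e = 1"
  shows "(a, b, c, d) \<in> pin_set e \<longleftrightarrow>
    b = 0 \<and> c = 0 \<and> a\<^sup>2 + d\<^sup>2 = 1 \<or> a = 0 \<and> d = 0 \<and> b\<^sup>2 + c\<^sup>2 = 1"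
proof
  have "s \<in> pin_set e \<Longrightarrow> case s of (a, b, c, d) \<Rightarrow>
      b = 0 \<and> c = 0 \<and> a\<^sup>2 + d\<^sup>2 = 1 \<or> a = 0 \<and> d = 0 \<and> b\<^sup>2 + c\<^sup>2 = 1" for s
  proof (induction rule: pin_set.induct)
    case one
    then show ?case by (simp add: cl_one_def)
  next
    case (step s v)
    obtain a b c d where s: "s = (a, b, c, d)" by (metis prod.collapse)
    define x y where "x = v $ 1" and "y = v $ 2"
    have v: "x\<^sup>2 + y\<^sup>2 = 1" using step.hyps(2) by (simp add: norm_real2_eq_1 x_def y_def)
    \<comment> \<open>Multiplicativity of the norm is the two-squares identity;
      \<open>e * e = 1\<close> absorbs the sign.\<close>
    have "(a * x + e * (d * y))\<^sup>2 + (a * y - e * (d * x))\<^sup>2 = 1" if "a\<^sup>2 + d\<^sup>2 = 1"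
    proof -
      have "(a * x + e * (d * y))\<^sup>2 + (a * y - e * (d * x))\<^sup>2 = (a\<^sup>2 + (e * e) * d\<^sup>2) * (x\<^sup>2 + y\<^sup>2)"
        by algebra
      then show ?thesis using that v e by simp
    qed
    moreover have "(e * (b * x + c * y))\<^sup>2 + (b * y - c * x)\<^sup>2 = 1" if "b\<^sup>2 + c\<^sup>2 = 1"
    proof -
      have "(e * (b * x + c * y))\<^sup>2 + (b * y - c * x)\<^sup>2
          = (e * e) * (b * x + c * y)\<^sup>2 + (b * y - c * x)\<^sup>2"
        by algebra
      also have "\<dots> = (b\<^sup>2 + c\<^sup>2) * (x\<^sup>2 + y\<^sup>2)" using e by algebra
      finally show ?thesis using that v by simp
    qed
    ultimately show ?case
      using step.IH by (auto simp: s cl_vec_def x_def[symmetric] y_def[symmetric])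
  qed
  then show "(a, b, c, d) \<in> pin_set e \<Longrightarrow>
      b = 0 \<and> c = 0 \<and> a\<^sup>2 + d\<^sup>2 = 1 \<or> a = 0 \<and> d = 0 \<and> b\<^sup>2 + c\<^sup>2 = 1"
    by fastforce
  assume "b = 0 \<and> c = 0 \<and> a\<^sup>2 + d\<^sup>2 = 1 \<or> a = 0 \<and> d = 0 \<and> b\<^sup>2 + c\<^sup>2 = 1"
  then show "(a, b, c, d) \<in> pin_set e"
  proof (elim disjE conjE)
    assume *: "b = 0" "c = 0" "a\<^sup>2 + d\<^sup>2 = 1"
    \<comment> \<open>The even element is factored as e1 w. Since e1 e1 = \<open>e\<close>, the
      first coordinate of w must be \<open>e * a\<close> to produce the scalar part a.\<close>
    define v w :: "real^2" where "v = vector [1, 0]" and "w = vector [e * a, d]"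
    have nv: "norm v = 1" by (simp add: norm_real2_eq_1 v_def)
    have "(e * a)\<^sup>2 = (e * e) * a\<^sup>2" by algebra
    with * e have nw: "norm w = 1" by (simp add: norm_real2_eq_1 w_def)
    have "cl_mult e (cl_mult e cl_one (cl_vec v)) (cl_vec w) \<in> pin_set e"
      by (intro pin_set.intros nv nw)
    moreover have "e * (e * a) = a" using e by (metis mult.assoc mult_1)
    ultimately show ?thesis using * by (simp add: cl_vec_def v_def w_def)
  next
    assume *: "a = 0" "d = 0" "b\<^sup>2 + c\<^sup>2 = 1"
    define v :: "real^2" where "v = vector [b, c]"
    have nv: "norm v = 1" using * by (simp add: norm_real2_eq_1 v_def)
    have "cl_mult e cl_one (cl_vec v) \<in> pin_set e"
      by (intro pin_set.intros nv)
    then show ?thesis using * by (simp add: cl_vec_def v_def)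
  qed
qed

lemma pin_set_cases [consumes 2, case_names even odd]:
  assumes "e * e = 1" "s \<in> pin_set e"
  obtains a d where "s = (a, 0, 0, d)" "a\<^sup>2 + d\<^sup>2 = 1"
  | b c where "s = (0, b, c, 0)" "b\<^sup>2 + c\<^sup>2 = 1"
  using assms pin_set_iff[OF assms(1)] by (cases s) blast

lemma pin_set_uminus [simp]:
  assumes "e * e = 1"
  shows "- s \<in> pin_set e \<longleftrightarrow> s \<in> pin_set e"
  by (cases s) (auto simp: pin_set_iff[OF assms])

text \<open>As the group lies on the unit sphere, inner products detect signs; this yields the half
  spheres separating s from - s and the sign comparing two lifts.\<close>

lemma pin_set_inner_self: "e * e = 1 \<Longrightarrow> s \<in> pin_set e \<Longrightarrow> s \<bullet> s = 1"
  by (erule (1) pin_set_cases) (simp_all add: inner_prod_def power2_eq_square)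

text \<open>The induction runs over the right factor because the group is generated by
  multiplication from the right.\<close>

lemma pin_set_mult:
  assumes e: "e * e = 1" and t: "t \<in> pin_set e" and s: "s \<in> pin_set e"
  shows "cl_mult e s t \<in> pin_set e"
  using t
proof (induction rule: pin_set.induct)
  case one
  then show ?case using s by simp
next
  case (step t v)
  then show ?case by (metis cl_mult_assoc[OF e] pin_set.step)
qed

text \<open>An inverse on the pin group only: complex conjugation on the even circle, where e1 e2
  squares to -1, and v to e v on the odd one.\<close>

definition cl_inv :: "real \<Rightarrow> cl2 \<Rightarrow> cl2" where
  "cl_inv e = (\<lambda>(a, b, c, d). (a, e * b, e * c, - d))"

lemma cl_inv:
  assumes e: "e * e = 1" and s: "s \<in> pin_set e"
  shows cl_inv_closed: "cl_inv e s \<in> pin_set e"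
    and cl_inv_left: "cl_mult e (cl_inv e s) s = cl_one"
    and cl_inv_right: "cl_mult e s (cl_inv e s) = cl_one"
proof -
  have e': "e * (e * x) = x" for x using e by (metis mult.assoc mult_1)
  from e s have "cl_inv e s \<in> pin_set e \<and> cl_mult e (cl_inv e s) s = cl_one
      \<and> cl_mult e s (cl_inv e s) = cl_one"
  proof (cases rule: pin_set_cases)
    case (even a d)
    then show ?thesis
      by (simp add: cl_inv_def pin_set_iff[OF e] cl_one_def power2_eq_square)
  next
    case (odd b c)
    then show ?thesis
      using e by (simp add: cl_inv_def pin_set_iff[OF e] cl_one_def power2_eq_square algebra_simps e')
  qed
  then show "cl_inv e s \<in> pin_set e" "cl_mult e (cl_inv e s) s = cl_one"
    "cl_mult e s (cl_inv e s) = cl_one" by auto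
qed

lemma pin_group_simps [simp]:
  "carrier (pin_group e) = pin_set e" "mult (pin_group e) = cl_mult e" "one (pin_group e) = cl_one"
  by (simp_all add: pin_group_def)

text \<open>\<open>pin_cover\<close> is defined through the abstract group inverse; uniqueness of
  inverses in a group identifies it with \<open>cl_inv\<close>.\<close>

lemma group_pin_group:
  assumes e: "e * e = 1"
  shows "group (pin_group e)"
  by (rule groupI)
    (auto simp: pin_set_mult[OF e] pin_set.one cl_mult_assoc[OF e] intro: cl_inv[OF e])

lemma inv_pin_group:
  assumes e: "e * e = 1" and s: "s \<in> pin_set e"
  shows "inv\<^bsub>pin_group e\<^esub> s = cl_inv e s"
  by (rule group.inv_equality[OF group_pin_group[OF e]]) (auto simp: s cl_inv[OF e])

section \<open>The covering of O(2)\<close>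

definition mat2 :: "real \<Rightarrow> real \<Rightarrow> real \<Rightarrow> real \<Rightarrow> real^2^2" where
  "mat2 p q r t = vector [vector [p, q], vector [r, t]]"

lemma mat2_nth [simp]:
  "mat2 p q r t $ 1 $ 1 = p" "mat2 p q r t $ 1 $ 2 = q"
  "mat2 p q r t $ 2 $ 1 = r" "mat2 p q r t $ 2 $ 2 = t"
  by (simp_all add: mat2_def)

lemma mat2_eqI:
  fixes A B :: "real^2^2"
  assumes "A $ 1 $ 1 = B $ 1 $ 1" "A $ 1 $ 2 = B $ 1 $ 2" "A $ 2 $ 1 = B $ 2 $ 1" "A $ 2 $ 2 = B $ 2 $ 2"
  shows "A = B"
  using assms by (simp add: vec_eq_iff forall_2)

lemma mat2_mult_nth: "((A :: real^2^2) ** B) $ i $ j = A $ i $ 1 * B $ 1 $ j + A $ i $ 2 * B $ 2 $ j"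
  by (simp add: matrix_matrix_mult_def sum_2)

lemma mat_one_nth2 [simp]:
  "(mat 1 :: real^2^2) $ 1 $ 1 = 1" "(mat 1 :: real^2^2) $ 1 $ 2 = 0"
  "(mat 1 :: real^2^2) $ 2 $ 1 = 0" "(mat 1 :: real^2^2) $ 2 $ 2 = 1"
  by (simp_all add: mat_def)

lemma j2_eq: "j2 = mat2 1 0 0 (- 1)"
  by (simp add: j2_def mat2_def)

lemma orthogonal_matrix2:
  "orthogonal_matrix (A :: real^2^2) \<longleftrightarrow>
    (A $ 1 $ 1)\<^sup>2 + (A $ 2 $ 1)\<^sup>2 = 1 \<and> (A $ 1 $ 2)\<^sup>2 + (A $ 2 $ 2)\<^sup>2 = 1 \<and>
    A $ 1 $ 1 * A $ 1 $ 2 + A $ 2 $ 1 * A $ 2 $ 2 = 0"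
  by (auto simp: orthogonal_matrix vec_eq_iff forall_2 mat2_mult_nth transpose_def power2_eq_square
      algebra_simps)

text \<open>One formula serves both parities because the terms of the other parity vanish. For a =
  cos t, d = sin t it is the rotation by - 2 e t; for a unit vector (b, c) it is the reflection I -
  2 v v^T.\<close>

lemma pin_cover_eq:
  assumes e: "e * e = 1" and s: "(a, b, c, d) \<in> pin_set e"
  shows "pin_cover e (a, b, c, d) = mat2 (a\<^sup>2 - d\<^sup>2 + c\<^sup>2 - b\<^sup>2) (2 * e * a * d - 2 * b * c)
     (- 2 * e * a * d - 2 * b * c) (a\<^sup>2 - d\<^sup>2 + b\<^sup>2 - c\<^sup>2)"
proof -
  have e': "e = 1 \<or> e = -1" using e by (simp add: square_eq_1_iff)
  show ?thesis
    using s unfolding pin_set_iff[OF e]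
    by (rule_tac mat2_eqI; insert e')
      (auto simp: pin_cover_def inv_pin_group[OF e s] matrix_def cl_inv_def cl_vec_def axis_def
        power2_eq_square algebra_simps)
qed

text \<open>With the parities of both factors and the sign of \<open>e\<close> fixed, every matrix
  entry becomes a polynomial identity.\<close>

lemma pin_cover_mult:
  assumes e: "e * e = 1" and s: "s \<in> pin_set e" and t: "t \<in> pin_set e"
  shows "pin_cover e (cl_mult e s t) = pin_cover e s ** pin_cover e t"
proof -
  obtain a b c d where sd: "s = (a, b, c, d)" by (metis prod.collapse)
  obtain a' b' c' d' where td: "t = (a', b', c', d')" by (metis prod.collapse)
  have st: "cl_mult e s t \<in> pin_set e" by (rule pin_set_mult[OF e t s])
  have e': "e = 1 \<or> e = -1" using e by (simp add: square_eq_1_iff)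
  have S: "b = 0 \<and> c = 0 \<or> a = 0 \<and> d = 0" using s by (auto simp: sd pin_set_iff[OF e])
  have T: "b' = 0 \<and> c' = 0 \<or> a' = 0 \<and> d' = 0" using t by (auto simp: td pin_set_iff[OF e])
  show ?thesis
    using s t st unfolding sd td cl_mult.simps
    apply (simp add: pin_cover_eq[OF e] del: One_nat_def)
    apply (rule mat2_eqI; insert S T e'; elim disjE conjE;
        simp add: mat2_mult_nth power2_eq_square algebra_simps)
    done
qed

lemma pin_cover_one: "e * e = 1 \<Longrightarrow> pin_cover e cl_one = mat 1"
  using pin_cover_eq[of e 1 0 0 0] pin_set.one[of e]
  by (auto simp: cl_one_def intro!: mat2_eqI)

lemma pin_cover_uminus: "e * e = 1 \<Longrightarrow> s \<in> pin_set e \<Longrightarrow> pin_cover e (- s) = pin_cover e s"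
  using pin_set_uminus[of e s] by (cases s) (simp add: pin_cover_eq)

lemma pin_cover_orthogonal:
  assumes e: "e * e = 1" and s: "s \<in> pin_set e"
  shows "orthogonal_matrix (pin_cover e s)"
  using e s
proof (cases rule: pin_set_cases)
  case (even a d)
  have "(a\<^sup>2 - d\<^sup>2)\<^sup>2 + (2 * e * a * d)\<^sup>2 = (a\<^sup>2 - d\<^sup>2)\<^sup>2 + (e * e) * (2 * a * d)\<^sup>2" by algebra
  also have "\<dots> = (a\<^sup>2 + d\<^sup>2)\<^sup>2" unfolding e by algebra
  finally show ?thesis
    using even s by (simp add: pin_cover_eq[OF e] orthogonal_matrix2 add.commute)
next
  case (odd b c)
  have "(b\<^sup>2 - c\<^sup>2)\<^sup>2 + (2 * b * c)\<^sup>2 = (b\<^sup>2 + c\<^sup>2)\<^sup>2" "(c\<^sup>2 - b\<^sup>2)\<^sup>2 + (2 * b * c)\<^sup>2 = (b\<^sup>2 + c\<^sup>2)\<^sup>2" by algebra+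
  then show ?thesis
    using odd s by (simp add: pin_cover_eq[OF e] orthogonal_matrix2 algebra_simps)
qed

text \<open>The first column determines an angle u, the determinant then determines the second
  column, and half of u gives the preimage.\<close>

lemma pin_cover_surj:
  assumes e: "e * e = 1" and A: "orthogonal_matrix A"
  obtains s where "s \<in> pin_set e" "pin_cover e s = A"
proof -
  define p q r t where "p = A $ 1 $ 1" and "q = A $ 1 $ 2" and "r = A $ 2 $ 1" and "t = A $ 2 $ 2"
  have *: "p\<^sup>2 + r\<^sup>2 = 1" "q\<^sup>2 + t\<^sup>2 = 1" "p * q + r * t = 0"
    using A by (auto simp: orthogonal_matrix2 p_def q_def r_def t_def)
  obtain u where u: "p = cos u" "r = sin u"
    using sincos_total_2pi[OF *(1)] by metis
  have half: "cos u = (cos (u/2))\<^sup>2 - (sin (u/2))\<^sup>2" "sin u = 2 * sin (u/2) * cos (u/2)"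
    using cos_double[of "u/2"] sin_double[of "u/2"] by simp_all
  have sc: "(cos (u/2))\<^sup>2 + (sin (u/2))\<^sup>2 = 1" by simp
  have A': "A = mat2 p q r t" by (rule mat2_eqI) (simp_all add: p_def q_def r_def t_def)
  \<comment> \<open>The determinant; it separates rotations from reflections.\<close>
  define k where "k = p * t - q * r"
  have "q = - k * r" "t = k * p" "k * k = 1" unfolding k_def using * by algebra+
  then have k: "k = 1 \<or> k = -1" by (simp add: square_eq_1_iff)
  from k show ?thesis
  proof
    assume k1: "k = 1"
    \<comment> \<open>An even element of angle t covers the rotation by - 2 e t, so t = - e u / 2 is
      required.\<close>
    define s :: cl2 where "s = (cos (u/2), 0, 0, - e * sin (u/2))"
    have "(- e * sin (u/2))\<^sup>2 = (e * e) * (sin (u/2))\<^sup>2" by algebra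
    then have sq: "(- e * sin (u/2))\<^sup>2 = (sin (u/2))\<^sup>2" using e by simp
    have "2 * e * cos (u/2) * (- e * sin (u/2)) = - ((e * e) * (2 * sin (u/2) * cos (u/2)))"
      by algebra
    then have off: "2 * e * cos (u/2) * (- e * sin (u/2)) = - r" using e u half by simp
    have s: "s \<in> pin_set e" using sc sq by (simp add: s_def pin_set_iff[OF e])
    have "pin_cover e s = A"
      unfolding s_def A' pin_cover_eq[OF e s[unfolded s_def]] using off
      by (intro mat2_eqI)
        (simp_all only: mat2_nth sq, simp_all add: u half k1 \<open>q = - k * r\<close> \<open>t = k * p\<close>)
    then show ?thesis using that s by blast
  next
    assume k1: "k = -1"
    \<comment> \<open>The mirror of this reflection has direction u / 2; s is its unit
      normal.\<close>
    define s :: cl2 where "s = (0, - sin (u/2), cos (u/2), 0)"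
    have "s \<in> pin_set e \<and> pin_cover e s = A"
      using sc pin_set_iff[OF e] unfolding s_def A'
      by (auto simp: pin_cover_eq[OF e] u half k1 \<open>q = - k * r\<close> \<open>t = k * p\<close>)
    then show ?thesis using that by blast
  qed
qed

text \<open>Passing to the quotient of t by s reduces the claim to the kernel of the
  covering.\<close>

lemma pin_cover_eq_iff:
  assumes e: "e * e = 1" and s: "s \<in> pin_set e" and t: "t \<in> pin_set e"
  shows "pin_cover e s = pin_cover e t \<longleftrightarrow> t = s \<or> t = - s"
proof
  assume eq: "pin_cover e s = pin_cover e t"
  define u where "u = cl_mult e (cl_inv e s) t"
  have u: "u \<in> pin_set e" unfolding u_def by (intro pin_set_mult e t cl_inv_closed s)
  have tu: "t = cl_mult e s u"
    unfolding u_def by (simp add: cl_mult_assoc[OF e, symmetric] cl_inv_right[OF e s])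
  have "pin_cover e u = pin_cover e (cl_inv e s) ** pin_cover e s"
    unfolding u_def eq by (intro pin_cover_mult e t cl_inv_closed s)
  also have "\<dots> = mat 1"
    by (simp add: pin_cover_mult[OF e, symmetric] cl_inv[OF e] s pin_cover_one[OF e])
  finally have u1: "pin_cover e u = mat 1" .
  from e u have "u = cl_one \<or> u = - cl_one"
  proof (cases rule: pin_set_cases)
    case (even a d)
    have "pin_cover e u $ 1 $ 1 = a\<^sup>2 - d\<^sup>2"
      using u unfolding even by (simp add: pin_cover_eq[OF e])
    then have "a\<^sup>2 - d\<^sup>2 = 1" by (simp add: u1)
    then have "d\<^sup>2 = 0" "a\<^sup>2 = 1" using even(2) by linarith+
    then show ?thesis using even(1) by (auto simp: cl_one_def power2_eq_1_iff)
  next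
    \<comment> \<open>The diagonal entries of a reflection are opposite to each other, so it cannot
      be the identity.\<close>
    case (odd b c)
    have "pin_cover e u $ 1 $ 1 = c\<^sup>2 - b\<^sup>2" "pin_cover e u $ 2 $ 2 = b\<^sup>2 - c\<^sup>2"
      using u unfolding odd by (simp_all add: pin_cover_eq[OF e])
    then have "c\<^sup>2 - b\<^sup>2 = 1" "b\<^sup>2 - c\<^sup>2 = 1" by (simp_all add: u1)
    then show ?thesis by linarith
  qed
  then show "t = s \<or> t = - s" using tu by auto
qed (auto simp: pin_cover_uminus[OF e s])

section \<open>Continuity and openness of the covering of O(2)\<close>

lemma continuous_on_mat2I:
  fixes f :: "'a::topological_space \<Rightarrow> real^2^2"
  assumes "\<And>i j. continuous_on S (\<lambda>x. f x $ i $ j)"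
  shows "continuous_on S f"
proof -
  have "f = (\<lambda>x. \<chi> i. \<chi> j. f x $ i $ j)" by (simp add: vec_eq_iff fun_eq_iff)
  moreover have "continuous_on S (\<lambda>x. \<chi> i. \<chi> j. f x $ i $ j)"
    by (intro continuous_on_vec_lambda assms)
  ultimately show ?thesis by simp
qed

lemma continuous_on_matrix_mult [continuous_intros]:
  fixes f g :: "'a::topological_space \<Rightarrow> real^2^2"
  assumes "continuous_on S f" "continuous_on S g"
  shows "continuous_on S (\<lambda>x. f x ** g x)"
  by (rule continuous_on_mat2I) (simp add: mat2_mult_nth, intro continuous_intros assms)

lemma continuous_on_cl_mult [continuous_intros]:
  fixes f g :: "'a::topological_space \<Rightarrow> cl2"
  assumes f: "continuous_on S f" and g: "continuous_on S g"
  shows "continuous_on S (\<lambda>x. cl_mult e (f x) (g x))"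
proof -
  have cl: "(\<lambda>x. cl_mult e (f x) (g x)) = (\<lambda>x. case f x of (a, b, c, d) \<Rightarrow> case g x of (a', b', c', d') \<Rightarrow>
       cl_mult e (a, b, c, d) (a', b', c', d'))"
    by (simp add: fun_eq_iff split: prod.split)
  show ?thesis
    unfolding cl unfolding cl_mult.simps case_prod_beta by (intro continuous_intros f g)
qed

text \<open>The group inverse inside \<open>pin_cover\<close> gives no continuity by itself, so the
  map is replaced by a polynomial that agrees with it on the pin group.\<close>

lemma continuous_on_pin_cover:
  assumes e: "e * e = 1"
  shows "continuous_on (pin_set e) (pin_cover e)"
proof -
  define F :: "cl2 \<Rightarrow> real^2^2" where
    "F = (\<lambda>(a, b, c, d). mat2 (a\<^sup>2 - d\<^sup>2 + c\<^sup>2 - b\<^sup>2) (2 * e * a * d - 2 * b * c)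
     (- 2 * e * a * d - 2 * b * c) (a\<^sup>2 - d\<^sup>2 + b\<^sup>2 - c\<^sup>2))"
  have "continuous_on (pin_set e) F"
  proof (rule continuous_on_mat2I)
    fix i j :: 2
    have "\<forall>i j. continuous_on (pin_set e) (\<lambda>x. F x $ i $ j)"
      by (simp add: forall_2 F_def case_prod_beta) (intro conjI continuous_intros)
    then show "continuous_on (pin_set e) (\<lambda>x. F x $ i $ j)" by blast
  qed
  moreover have "F s = pin_cover e s" if "s \<in> pin_set e" for s
    using that by (cases s rule: prod_cases4) (simp add: F_def pin_cover_eq[OF e])
  ultimately show ?thesis by (metis (no_types, lifting) continuous_on_cong)
qed

text \<open>Two continuous images of a closed interval, one for each circle. Compactness makes the
  covering a closed map.\<close>

lemma compact_pin_set:
  assumes e: "e * e = 1"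
  shows "compact (pin_set e)"
proof -
  define f g :: "real \<Rightarrow> cl2" where "f = (\<lambda>t. (cos t, 0, 0, sin t))" and "g = (\<lambda>t. (0, cos t, sin t, 0))"
  have "pin_set e = f ` {0..2*pi} \<union> g ` {0..2*pi}"
  proof
    show "pin_set e \<subseteq> f ` {0..2*pi} \<union> g ` {0..2*pi}"
    proof
      fix s assume "s \<in> pin_set e"
      with e show "s \<in> f ` {0..2*pi} \<union> g ` {0..2*pi}"
      proof (cases rule: pin_set_cases)
        case (even a d)
        then obtain t where "t \<in> {0..2*pi}" "a = cos t" "d = sin t"
          using sincos_total_2pi[OF even(2)] by (metis atLeastAtMost_iff less_imp_le)
        then show ?thesis by (auto simp: f_def even)
      next
        case (odd a d)
        then obtain t where "t \<in> {0..2*pi}" "a = cos t" "d = sin t"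
          using sincos_total_2pi[OF odd(2)] by (metis atLeastAtMost_iff less_imp_le)
        then show ?thesis by (auto simp: g_def odd)
      qed
    qed
  qed (auto simp: f_def g_def pin_set_iff[OF e])
  moreover have "continuous_on {0..2*pi} f" "continuous_on {0..2*pi} g"
    unfolding f_def g_def by (intro continuous_intros)+
  ultimately show ?thesis by (simp add: compact_Un compact_continuous_image)
qed

lemma pin_cover_image: "e * e = 1 \<Longrightarrow> pin_cover e ` pin_set e = {A. orthogonal_matrix A}"
  using pin_cover_orthogonal pin_cover_surj by blast

text \<open>The complement of the saturation of U under s to - s is closed, hence has closed image
  by compactness. As fibres are pairs s, - s, that image is the complement of the image of
  U.\<close>

lemma open_map_pin_cover:
  assumes e: "e * e = 1"
  shows "open_map (top_of_set (pin_set e)) (top_of_set {A. orthogonal_matrix A}) (pin_cover e)"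
  unfolding open_map_def
proof (intro allI impI)
  fix U assume U: "openin (top_of_set (pin_set e)) U"
  then have US: "U \<subseteq> pin_set e" by (simp add: openin_imp_subset)
  obtain T where T: "open T" "U = pin_set e \<inter> T" using U by (auto simp: openin_open)
  have "closedin (top_of_set (pin_set e)) (pin_set e \<inter> (- T \<inter> - uminus ` T))"
    by (intro closedin_closed_Int closed_Int) (use T in \<open>auto simp: open_negations\<close>)
  also have "pin_set e \<inter> (- T \<inter> - uminus ` T) = pin_set e - (U \<union> uminus ` U)"
  proof -
    have "x \<in> uminus ` T \<longleftrightarrow> x \<in> uminus ` U" if "x \<in> pin_set e" for x
    proof -
      have *: "x \<in> uminus ` V \<longleftrightarrow> - x \<in> V" for V by (metis image_iff minus_minus)
      show ?thesis using that T(2) pin_set_uminus[OF e] by (simp add: *)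
    qed
    then show ?thesis using T(2) by blast
  qed
  finally have cl0: "closedin (top_of_set (pin_set e)) (pin_set e - (U \<union> uminus ` U))" .
  have cl: "closedin (top_of_set {A. orthogonal_matrix A}) (pin_cover e ` (pin_set e - (U \<union> uminus ` U)))"
    by (rule Abstract_Topology_2.continuous_imp_closed_map[OF cl0 continuous_on_pin_cover[OF e] pin_cover_image[OF e]
          compact_pin_set[OF e]])
  have *: "pin_cover e s \<in> pin_cover e ` U \<longleftrightarrow> s \<in> U \<union> uminus ` U" if s: "s \<in> pin_set e" for s
  proof
    assume "pin_cover e s \<in> pin_cover e ` U"
    then obtain t where t: "t \<in> U" "pin_cover e t = pin_cover e s" by (metis imageE)
    then have "s = t \<or> s = - t" using pin_cover_eq_iff[OF e _ s] US by blast
    then show "s \<in> U \<union> uminus ` U" using t(1) by blast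
  next
    assume "s \<in> U \<union> uminus ` U"
    then obtain t where t: "t \<in> U" "s = t \<or> s = - t" by blast
    then have "pin_cover e s = pin_cover e t" using pin_cover_uminus[OF e] US by blast
    then show "pin_cover e s \<in> pin_cover e ` U" using t(1) by simp
  qed
  have "pin_cover e ` (pin_set e - (U \<union> uminus ` U)) = pin_cover e ` pin_set e - pin_cover e ` U"
  proof (intro equalityI subsetI)
    fix y assume "y \<in> pin_cover e ` (pin_set e - (U \<union> uminus ` U))"
    then obtain s where s: "s \<in> pin_set e" "s \<notin> U \<union> uminus ` U" and y: "y = pin_cover e s" by blast
    show "y \<in> pin_cover e ` pin_set e - pin_cover e ` U"
      unfolding y Diff_iff *[OF s(1)] using s by (intro conjI imageI)
  next
    fix y assume y: "y \<in> pin_cover e ` pin_set e - pin_cover e ` U"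
    then obtain s where s: "s \<in> pin_set e" and ys: "y = pin_cover e s" by blast
    have "s \<notin> U \<union> uminus ` U" using y unfolding ys Diff_iff *[OF s] by (rule conjunct2)
    then show "y \<in> pin_cover e ` (pin_set e - (U \<union> uminus ` U))"
      unfolding ys using s by (intro imageI DiffI)
  qed
  moreover have "pin_cover e ` U \<subseteq> {A. orthogonal_matrix A}"
    using US pin_cover_image[OF e] by blast
  ultimately show "openin (top_of_set {A. orthogonal_matrix A}) (pin_cover e ` U)"
    using cl pin_cover_image[OF e] by (simp add: openin_closedin_eq)
qed

section \<open>Smoothness of affine maps\<close>

lemma Ck_on_const: "Ck_on k (\<lambda>x. c) N"
proof (induction k arbitrary: c)
  case (Suc k)
  show ?case by (auto intro!: exI[of _ "\<lambda>x v. 0"] Suc.IH)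
qed simp

text \<open>The derivative is T at every point, so in each direction v the function to be
  differentiated further is the constant T v.\<close>

lemma smooth_on_affine:
  assumes T: "bounded_linear T"
  shows "smooth_on (\<lambda>x. T x + c) N"
  unfolding smooth_on_def
proof
  fix k
  show "Ck_on k (\<lambda>x. T x + c) N"
  proof (cases k)
    case 0
    then show ?thesis
      by (simp, intro continuous_intros bounded_linear.continuous_on[OF T])
  next
    case (Suc k')
    have "((\<lambda>x. T x + c) has_derivative T) (at x)" for x
      by (auto intro!: derivative_eq_intros bounded_linear_imp_has_derivative[OF T])
    then show ?thesis
      unfolding Suc by (auto intro!: exI[of _ "\<lambda>x. T"] Ck_on_const)
  qed
qed

lemma smooth_frame_map_id:
  assumes "\<And>f. f \<in> W \<Longrightarrow> H f = f"
  shows "smooth_frame_map W H"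
  unfolding smooth_frame_map_def
proof (intro allI impI)
  fix z assume "unroll z \<in> W"
  have "smooth_on (\<lambda>x. x + 0) (UNIV :: ((real \<times> real) \<times> (real^2^2)) set)"
    by (intro smooth_on_affine bounded_linear_ident)
  then show "\<exists>N G. open N \<and> z \<in> N \<and> smooth_on G N \<and> (\<forall>y\<in>N. unroll y \<in> W \<longrightarrow> H (unroll y) = unroll (G y))"
    using assms by (intro exI[of _ UNIV] exI[of _ "\<lambda>x. x"]) auto
qed

lemma smooth_frame_map_dtau:
  assumes "\<And>f. f \<in> W \<Longrightarrow> H f = dtau f"
  shows "smooth_frame_map W H"
  unfolding smooth_frame_map_def
proof (intro allI impI)
  fix z assume "unroll z \<in> W"
  \<comment> \<open>The linear part of \<open>dtau\<close> on the universal cover; the shift by pi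
    in theta is the translation part added below.\<close>
  define T :: "(real \<times> real) \<times> (real^2^2) \<Rightarrow> (real \<times> real) \<times> (real^2^2)"
    where "T = (\<lambda>((a, b), A). ((a, - b), j2 ** A))"
  have "linear T"
    by (rule linearI)
      (auto simp: T_def vec_eq_iff mat2_mult_nth algebra_simps)
  then have "smooth_on (\<lambda>x. T x + ((pi, 0), 0)) UNIV"
    by (intro smooth_on_affine) (simp add: linear_conv_bounded_linear)
  moreover have "dtau (unroll y) = unroll (T y + ((pi, 0), 0))" for y
    by (cases y) (auto simp: dtau_def tau_def unroll_def T_def plus_angle.abs_eq uminus_angle.abs_eq)
  ultimately show "\<exists>N G. open N \<and> z \<in> N \<and> smooth_on G N \<and> (\<forall>y\<in>N. unroll y \<in> W \<longrightarrow> H (unroll y) = unroll (G y))"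
    using assms by (intro exI[of _ UNIV] exI[of _ "\<lambda>x. T x + ((pi, 0), 0)"]) auto
qed

section \<open>Topology of the torus and of the Klein bottle\<close>

lemma continuous_angle: "continuous_on UNIV angle"
  by (simp add: continuous_on_open_vimage open_angle_def)

lemma angle_surj: obtains a where "x = angle a"
  by (metis angle.abs_eq_iff Quotient3_angle Quotient3_abs_rep)

lemma continuous_on_angleI:
  assumes "continuous_on UNIV (\<lambda>a. f (angle a))"
  shows "continuous_on UNIV f"
  using assms by (simp add: continuous_on_open_vimage open_angle_def vimage_def)

text \<open>The saturation of U is the union of its translates by multiples of 2 pi.\<close>

lemma open_angle_image:
  assumes "open U"
  shows "open (angle ` U)"
proof -
  have "angle -` (angle ` U) = (\<Union>k::int. (+) (2 * pi * of_int k) ` U)"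
  proof (intro equalityI subsetI)
    fix x assume "x \<in> angle -` (angle ` U)"
    then obtain u k where "u \<in> U" "x - u = 2 * pi * of_int k"
      by (auto simp: angle.abs_eq_iff angle_rel_def)
    then have "x \<in> (+) (2 * pi * of_int k) ` U" by (intro image_eqI[of _ _ u]) auto
    then show "x \<in> (\<Union>k::int. (+) (2 * pi * of_int k) ` U)" by blast
  next
    fix x assume "x \<in> (\<Union>k::int. (+) (2 * pi * of_int k) ` U)"
    then obtain u k where "u \<in> U" "x = 2 * pi * of_int k + u" by auto
    then have "angle x = angle u" by (auto simp: angle.abs_eq_iff angle_rel_def)
    then show "x \<in> angle -` (angle ` U)" using \<open>u \<in> U\<close> by auto
  qed
  then show ?thesis
    unfolding open_angle_def by (auto intro!: open_UN open_translation assms)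
qed

lemma continuous_rot: "continuous_on UNIV rot"
proof (intro continuous_on_angleI continuous_on_mat2I)
  fix i j :: 2
  have "\<forall>i j. continuous_on UNIV (\<lambda>a. rot (angle a) $ i $ j)"
    by (simp add: forall_2 rot.abs_eq, intro conjI continuous_intros)
  then show "continuous_on UNIV (\<lambda>a. rot (angle a) $ i $ j)" by blast
qed

lemma continuous_tau: "continuous_on UNIV tau"
proof -
  have "continuous_on UNIV (\<lambda>\<theta>. \<theta> + angle pi)"
    by (intro continuous_on_angleI)
      (simp add: plus_angle.abs_eq, intro continuous_on_compose2[OF continuous_angle] continuous_intros, simp)
  then have "continuous_on UNIV (\<lambda>x::torus. fst x + angle pi)"
    by (rule continuous_on_compose2[where g="\<lambda>\<theta>. \<theta> + angle pi"]) (auto intro: continuous_intros)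
  moreover have "continuous_on UNIV (uminus :: angle \<Rightarrow> angle)"
    by (intro continuous_on_angleI)
      (simp add: uminus_angle.abs_eq, intro continuous_on_compose2[OF continuous_angle] continuous_intros, simp)
  then have "continuous_on UNIV (\<lambda>x::torus. - snd x)"
    by (rule continuous_on_compose2[where g=uminus]) (auto intro: continuous_intros)
  ultimately show ?thesis
    unfolding tau_def case_prod_beta by (intro continuous_on_Pair)
qed

lemma connected_torus: "connected (UNIV :: torus set)"
proof -
  have "connected (range angle)"
    by (intro connected_continuous_image continuous_angle connected_UNIV)
  moreover have "range angle = UNIV" by (auto intro: angle_surj)
  ultimately show ?thesis
    using connected_Times[of "UNIV :: angle set" "UNIV :: angle set"] by simp
qed

text \<open>Quantitative freeness of the involution: a band of width pi in theta is moved off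
  itself. Every local argument over the Klein bottle rests on this W.\<close>

lemma tau_displaces:
  obtains W where "open W" "x \<in> W" "\<And>y. y \<in> W \<Longrightarrow> tau y \<notin> W"
proof -
  obtain \<theta> \<phi> where x: "x = (\<theta>, \<phi>)" by (metis prod.collapse)
  obtain a where a: "\<theta> = angle a" by (rule angle_surj)
  define W :: "torus set" where "W = angle ` {a - pi / 2 <..< a + pi / 2} \<times> UNIV"
  have "open W" unfolding W_def by (intro open_Times open_angle_image) auto
  moreover have "x \<in> W" by (auto simp: W_def x a)
  moreover have "tau y \<notin> W" if yW: "y \<in> W" for y
  proof
    assume tW: "tau y \<in> W"
    obtain u where u: "fst y = angle u" "a - pi / 2 < u" "u < a + pi / 2"
      using yW by (auto simp: W_def)
    obtain v where v: "fst (tau y) = angle v" "a - pi / 2 < v" "v < a + pi / 2"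
      using tW by (auto simp: W_def)
    have "angle (u + pi) = angle v"
      using u v by (simp add: tau_def case_prod_beta plus_angle.abs_eq)
    then obtain k :: int where k: "u + pi - v = 2 * pi * of_int k"
      by (auto simp: angle.abs_eq_iff angle_rel_def)
    \<comment> \<open>Both u and v are within pi / 2 of a, so u + pi - v lies strictly between 0 and
      2 pi, where there is no multiple of 2 pi.\<close>
    have "0 < 2 * pi * of_int k" "2 * pi * of_int k < 2 * pi * 1" using k u v by linarith+
    then have "0 < k" "k < 1"
      by (simp_all only: mult_less_cancel_left_pos zero_less_mult_iff) auto
    then show False by simp
  qed
  ultimately show ?thesis by (rule that)
qed

lemma tau_neq: "tau x \<noteq> x"
  using tau_displaces[of x] by metis

lemma klein_pi_eq_iff: "klein_pi x = klein_pi y \<longleftrightarrow> y = x \<or> y = tau x"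
  by (simp add: klein.abs_eq_iff klein_rel_def)

lemma klein_pi_surj: obtains x where "b = klein_pi x"
  by (metis Quotient3_klein Quotient3_abs_rep)

lemma continuous_klein_pi: "continuous_on UNIV klein_pi"
  by (simp add: continuous_on_open_vimage open_klein_def)

text \<open>The saturation of U is its union with the preimage under \<open>tau\<close>. The same
  argument with \<open>dtau\<close> serves for \<open>dpi\<close>.\<close>

lemma open_klein_pi_image: "open U \<Longrightarrow> open (klein_pi ` U)"
proof -
  assume U: "open U"
  have "klein_pi -` (klein_pi ` U) = U \<union> tau -` U"
    unfolding set_eq_iff vimage_eq image_iff Un_iff klein_pi_eq_iff by blast
  moreover have "open (tau -` U)"
    using U continuous_tau by (simp add: continuous_on_open_vimage)
  ultimately show ?thesis using U by (simp add: open_klein_def open_Un)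
qed

lemma dpi_eq_iff: "dpi f = dpi g \<longleftrightarrow> g = f \<or> g = dtau f"
  by (simp add: kpair.abs_eq_iff kpair_rel_def)

lemma dpi_surj: obtains f where "k = dpi f"
  by (metis Quotient3_kpair Quotient3_abs_rep)

lemma continuous_dpi: "continuous_on UNIV dpi"
  by (simp add: continuous_on_open_vimage open_kpair_def)

lemma continuous_dtau: "continuous_on UNIV dtau"
  unfolding dtau_def case_prod_beta
  by (intro continuous_intros continuous_on_compose2[OF continuous_tau]) auto

lemma open_dpi_image: "open U \<Longrightarrow> open (dpi ` U)"
proof -
  assume U: "open U"
  have "dpi -` (dpi ` U) = U \<union> dtau -` U"
    unfolding set_eq_iff vimage_eq image_iff Un_iff dpi_eq_iff by blast
  moreover have "open (dtau -` U)"
    using U continuous_dtau by (simp add: continuous_on_open_vimage)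
  ultimately show ?thesis using U by (simp add: open_kpair_def open_Un)
qed

lemma fst_dtau [simp]: "fst (dtau f) = tau (fst f)"
  by (simp add: dtau_def case_prod_beta)

section \<open>The frame bundles\<close>

abbreviation O2 :: "(real^2^2) set" where
  "O2 \<equiv> {A. orthogonal_matrix A}"

lemma orthogonal_j2: "orthogonal_matrix j2"
  by (simp add: j2_eq orthogonal_matrix2)

lemma frames_T2_simps [simp]:
  "frames frames_T2 = top_of_set (UNIV \<times> O2)"
  "frame_base frames_T2 = fst"
  "frame_act frames_T2 (x, A) B = (x, A ** B)"
  using prod_topology_subtopology_eu[of UNIV O2] by (simp_all add: frames_T2_def)

lemma frames_K2_simps [simp]:
  "frames frames_K2 = top_of_set (dpi ` (UNIV \<times> O2))"
  "frame_base frames_K2 = kpair_base"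
  "frame_act frames_K2 = kpair_act"
proof -
  have "{f. kpair_orthonormal f} = dpi ` (UNIV \<times> O2)"
  proof (intro equalityI subsetI)
    fix k assume k: "k \<in> {f. kpair_orthonormal f}"
    obtain f where f: "k = dpi f" by (rule dpi_surj)
    then have "f \<in> UNIV \<times> O2" using k by (auto simp: kpair_orthonormal.abs_eq)
    then show "k \<in> dpi ` (UNIV \<times> O2)" using f by blast
  qed (auto simp: kpair_orthonormal.abs_eq)
  then show "frames frames_K2 = top_of_set (dpi ` (UNIV \<times> O2))" by (simp add: frames_K2_def)
qed (simp_all add: frames_K2_def)

lemma dtau_frame_iff [simp]: "dtau f \<in> UNIV \<times> O2 \<longleftrightarrow> f \<in> UNIV \<times> O2"
proof -
  have *: "f \<in> UNIV \<times> O2 \<Longrightarrow> dtau f \<in> UNIV \<times> O2" for f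
    by (auto simp: dtau_def orthogonal_matrix_mul orthogonal_j2)
  show ?thesis using *[of f] *[of "dtau f"] by (auto simp: dtau_dtau)
qed

text \<open>Openness survives the restriction to orthonormal frames because these form a set
  saturated under \<open>dtau\<close>.\<close>

lemma open_map_dpi: "open_map (frames frames_T2) (frames frames_K2) dpi"
  unfolding open_map_def
proof (intro allI impI)
  fix U assume "openin (frames frames_T2) U"
  then obtain T where T: "open T" "U = (UNIV \<times> O2) \<inter> T" by (auto simp: openin_open)
  have "dpi ` U = dpi ` (UNIV \<times> O2) \<inter> dpi ` T"
  proof (intro equalityI subsetI)
    fix k assume "k \<in> dpi ` (UNIV \<times> O2) \<inter> dpi ` T"
    then obtain f g where fg: "f \<in> UNIV \<times> O2" "g \<in> T" "k = dpi f" "k = dpi g" by blast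
    then have "g = f \<or> g = dtau f" using dpi_eq_iff by metis
    then have "g \<in> UNIV \<times> O2" using fg(1) dtau_frame_iff by metis
    then show "k \<in> dpi ` U" using fg T by blast
  qed (use T in blast)
  then show "openin (frames frames_K2) (dpi ` U)"
    using open_dpi_image[OF T(1)] by (auto simp: openin_open)
qed

lemma continuous_map_dpi: "continuous_map (frames frames_T2) (frames frames_K2) dpi"
  using continuous_on_subset[OF continuous_dpi]
  by (auto simp: continuous_map_in_subtopology)

section \<open>Coverings\<close>

text \<open>Openness passes to products, a property that general quotient maps do not have; the
  action on a quotient bundle depends on it.\<close>

lemma open_map_prod:
  assumes f: "open_map X X' f" and g: "open_map Y Y' g"
  shows "open_map (prod_topology X Y) (prod_topology X' Y') (\<lambda>(x, y). (f x, g y))"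
  unfolding open_map_def openin_prod_topology_alt
proof (intro allI impI)
  fix S x' y'
  assume S: "\<forall>x y. (x, y) \<in> S \<longrightarrow> (\<exists>U V. openin X U \<and> openin Y V \<and> x \<in> U \<and> y \<in> V \<and> U \<times> V \<subseteq> S)"
    and "(x', y') \<in> (\<lambda>(x, y). (f x, g y)) ` S"
  then obtain x y where xy: "(x, y) \<in> S" "x' = f x" "y' = g y" by auto
  from S[rule_format, OF xy(1)] obtain U V
    where UV: "openin X U" "openin Y V" "x \<in> U" "y \<in> V" "U \<times> V \<subseteq> S" by blast
  have "f ` U \<times> g ` V = (\<lambda>(x, y). (f x, g y)) ` (U \<times> V)" by (rule image_paired_Times[symmetric])
  also have "\<dots> \<subseteq> (\<lambda>(x, y). (f x, g y)) ` S" by (rule image_mono[OF UV(5)])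
  finally show "\<exists>U V. openin X' U \<and> openin Y' V \<and> x' \<in> U \<and> y' \<in> V \<and> U \<times> V \<subseteq> (\<lambda>(x, y). (f x, g y)) ` S"
    using UV f g xy by (intro exI[of _ "f ` U"] exI[of _ "g ` V"]) (simp add: open_map_def)
qed

text \<open>If U is moved off itself by the sheet exchange, c is injective on U and on its mirror
  image, these have the same image under c, and together they fill the preimage of that
  image.\<close>

lemma two_fold_coveringI:
  assumes cont: "continuous_map P F c" and op: "open_map P F c"
    and surj: "c ` topspace P = topspace F"
    and opi: "\<And>U. openin P U \<Longrightarrow> openin P (\<sigma> ` U)"
    and fib: "\<And>p p'. p \<in> topspace P \<Longrightarrow> p' \<in> topspace P \<Longrightarrow> c p = c p' \<longleftrightarrow> p' = p \<or> p' = \<sigma> p"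
    and nb: "\<And>p. p \<in> topspace P \<Longrightarrow> \<exists>U. openin P U \<and> p \<in> U \<and> disjnt U (\<sigma> ` U)"
  shows "two_fold_covering P F c"
  unfolding two_fold_covering_def
proof (intro conjI ballI cont)
  fix f assume "f \<in> topspace F"
  then obtain p where p: "p \<in> topspace P" "f = c p" using surj by blast
  obtain U where U: "openin P U" "p \<in> U" "disjnt U (\<sigma> ` U)" using nb[OF p(1)] by blast
  have US: "U \<subseteq> topspace P" and sUS: "\<sigma> ` U \<subseteq> topspace P"
    using U opi by (auto dest: openin_subset)
  have c\<sigma>: "c (\<sigma> u) = c u" if "u \<in> U" for u
    using fib[of u "\<sigma> u"] that US sUS by (metis image_subset_iff subsetD)
  have injU: "inj_on c U"
  proof (rule inj_onI)
    fix u u' assume u: "u \<in> U" "u' \<in> U" "c u = c u'"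
    then have "u' = u \<or> u' = \<sigma> u" using fib US by blast
    then show "u = u'" using u U(3) by (auto simp: disjnt_iff)
  qed
  then have injs: "inj_on c (\<sigma> ` U)" using c\<sigma> by (auto simp: inj_on_def)
  have hom: "homeomorphic_map (subtopology P T) (subtopology F (c ` U)) c"
    if T: "openin P T" "inj_on c T" "c ` T = c ` U" for T
  proof (rule bijective_open_imp_homeomorphic_map)
    have TS: "T \<subseteq> topspace P" using T(1) by (rule openin_subset)
    then have ts: "topspace (subtopology P T) = T" by auto
    show "continuous_map (subtopology P T) (subtopology F (c ` U)) c"
      using T cont by (auto simp: continuous_map_in_subtopology continuous_map_from_subtopology)
    show "open_map (subtopology P T) (subtopology F (c ` U)) c"
      using T ts by (intro open_map_into_subtopology open_map_from_subtopology op) auto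
    show "c ` topspace (subtopology P T) = topspace (subtopology F (c ` U))"
    proof -
      have "c ` U \<subseteq> topspace F" using US surj by blast
      then show ?thesis using TS T(3) by (simp add: Int_absorb1)
    qed
    show "inj_on c (topspace (subtopology P T))" using ts T(2) by simp
  qed
  have cs: "c ` \<sigma> ` U = c ` U" using c\<sigma> by (auto simp: image_iff)
  have "\<Union>{U, \<sigma> ` U} = {p \<in> topspace P. c p \<in> c ` U}"
  proof (intro equalityI subsetI)
    fix q assume "q \<in> {p \<in> topspace P. c p \<in> c ` U}"
    then obtain u where u: "q \<in> topspace P" "u \<in> U" "c q = c u" by auto
    then have "q = u \<or> q = \<sigma> u" using fib[of u q] US by auto
    then show "q \<in> \<Union>{U, \<sigma> ` U}" using u by auto
  qed (use US sUS c\<sigma> in auto)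
  \<comment> \<open>Disjointness alone would permit two empty sheets; the point p makes them
    distinct, so the family has exactly two members.\<close>
  moreover have "U \<noteq> \<sigma> ` U" using U(2,3) by (auto simp: disjnt_iff)
  ultimately show "\<exists>V \<U>. openin F V \<and> f \<in> V \<and> card \<U> = 2 \<and> pairwise disjnt \<U> \<and>
      \<Union>\<U> = {p \<in> topspace P. c p \<in> V} \<and>
      (\<forall>U\<in>\<U>. openin P U \<and> homeomorphic_map (subtopology P U) (subtopology F V) c)"
    using U opi op p hom[OF U(1) injU] hom[OF opi[OF U(1)] injs cs]
    by (intro exI[of _ "c ` U"] exI[of _ "{U, \<sigma> ` U}"])
      (auto simp: open_map_def pairwise_insert disjnt_sym)
qed

lemma two_fold_covering_sheet:
  assumes "two_fold_covering P F c" and p: "p \<in> topspace P"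
  obtains U V where "openin P U" "p \<in> U" "openin F V"
    "homeomorphic_map (subtopology P U) (subtopology F V) c"
proof -
  have "c p \<in> topspace F" using assms by (auto simp: two_fold_covering_def continuous_map_def)
  then obtain V \<U> where "openin F V" "c p \<in> V" and *: "\<Union>\<U> = {p \<in> topspace P. c p \<in> V}"
    "\<forall>U\<in>\<U>. openin P U \<and> homeomorphic_map (subtopology P U) (subtopology F V) c"
    using assms by (auto simp: two_fold_covering_def)
  moreover obtain U where "U \<in> \<U>" "p \<in> U" using * \<open>c p \<in> V\<close> p by blast
  ultimately show ?thesis using that by blast
qed

lemma sheet_image:
  assumes "openin P U" "openin F V" "homeomorphic_map (subtopology P U) (subtopology F V) c"
  shows "c ` U = V" "inj_on c U"
  using homeomorphic_imp_surjective_map[OF assms(3)] homeomorphic_imp_injective_map[OF assms(3)]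
    openin_subset[OF assms(1)] openin_subset[OF assms(2)]
  by (simp_all add: topspace_subtopology Int_absorb1)

text \<open>Such a bijection is open because the target projection is injective on sheets.\<close>

lemma homeomorphic_map_over_identity:
  assumes op: "open_map P F c" and cov: "two_fold_covering P' F c'"
    and cont: "continuous_map P P' f" and bij: "bij_betw f (topspace P) (topspace P')"
    and over: "\<And>p. p \<in> topspace P \<Longrightarrow> c' (f p) = c p"
  shows "homeomorphic_map P P' f"
proof (rule bijective_open_imp_homeomorphic_map)
  show "open_map P P' f"
    unfolding open_map_def
  proof (intro allI impI)
    fix T assume T: "openin P T"
    then have TS: "T \<subseteq> topspace P" by (rule openin_subset)
    have contc': "continuous_map P' F c'" using cov by (simp add: two_fold_covering_def)
    show "openin P' (f ` T)"
    proof (subst openin_subopen, intro ballI)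
      fix y assume "y \<in> f ` T"
      then obtain z where z: "z \<in> T" "y = f z" by blast
      have "f z \<in> topspace P'" using z TS bij by (auto simp: bij_betw_def)
      then obtain U V where U: "openin P' U" "f z \<in> U" "openin F V"
        "homeomorphic_map (subtopology P' U) (subtopology F V) c'"
        by (rule two_fold_covering_sheet[OF cov])
      have "openin P {x \<in> topspace P. f x \<in> U}"
        by (rule openin_continuous_map_preimage[OF cont U(1)])
      then have "openin F (c ` ({x \<in> topspace P. f x \<in> U} \<inter> T))"
        using op T by (simp add: open_map_def openin_Int)
      then have "openin P' ({w \<in> topspace P'. c' w \<in> c ` ({x \<in> topspace P. f x \<in> U} \<inter> T)} \<inter> U)"
        by (intro openin_Int openin_continuous_map_preimage[OF contc'] U(1))
      moreover have "y \<in> {w \<in> topspace P'. c' w \<in> c ` ({x \<in> topspace P. f x \<in> U} \<inter> T)} \<inter> U"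
        using z TS U \<open>f z \<in> topspace P'\<close> over by auto
      moreover have "{w \<in> topspace P'. c' w \<in> c ` ({x \<in> topspace P. f x \<in> U} \<inter> T)} \<inter> U \<subseteq> f ` T"
      proof
        fix w assume "w \<in> {w \<in> topspace P'. c' w \<in> c ` ({x \<in> topspace P. f x \<in> U} \<inter> T)} \<inter> U"
        then obtain x where x: "w \<in> U" "x \<in> T" "f x \<in> U" "c' w = c x" by auto
        then have "c' w = c' (f x)" using over TS by auto
        then have "w = f x" using sheet_image(2)[OF U(1,3,4)] x by (auto simp: inj_on_def)
        then show "w \<in> f ` T" using x by blast
      qed
      ultimately show "\<exists>S. openin P' S \<and> y \<in> S \<and> S \<subseteq> f ` T" by blast
    qed
  qed
qed (use cont bij in \<open>auto simp: bij_betw_def\<close>)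

section \<open>Smoothness of bundle maps in sheet coordinates\<close>

lemma pin_smooth_over:
  assumes cov: "two_fold_covering (pin_total S) (frames frames_T2) (pin_xi S)"
    and cont: "continuous_map (pin_total S) (pin_total S') f"
    and over: "\<And>p. p \<in> topspace (pin_total S) \<Longrightarrow> pin_xi S' (f p) = H (pin_xi S p)"
    and H: "H = id \<or> H = dtau"
  shows "pin_smooth S S' f"
  unfolding pin_smooth_def
proof (intro conjI cont ballI)
  fix p assume "p \<in> topspace (pin_total S)"
  then obtain U V where U: "openin (pin_total S) U" "p \<in> U" "openin (frames frames_T2) V"
    "homeomorphic_map (subtopology (pin_total S) U) (subtopology (frames frames_T2) V) (pin_xi S)"
    by (rule two_fold_covering_sheet[OF cov])
  have "(pin_xi S' \<circ> f \<circ> inv_into U (pin_xi S)) v = H v" if "v \<in> V" for v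
  proof -
    have "v \<in> pin_xi S ` U" using that sheet_image(1)[OF U(1,3,4)] by simp
    then have "inv_into U (pin_xi S) v \<in> U" "pin_xi S (inv_into U (pin_xi S) v) = v"
      by (auto intro: inv_into_into f_inv_into_f)
    then show ?thesis using over openin_subset[OF U(1)] by auto
  qed
  then have "smooth_frame_map V (pin_xi S' \<circ> f \<circ> inv_into U (pin_xi S))"
    using H by (metis id_apply smooth_frame_map_id smooth_frame_map_dtau)
  then show "\<exists>U V. openin (pin_total S) U \<and> p \<in> U \<and> openin (frames frames_T2) V \<and>
        homeomorphic_map (subtopology (pin_total S) U) (subtopology (frames frames_T2) V) (pin_xi S) \<and>
        smooth_frame_map V (pin_xi S' \<circ> f \<circ> inv_into U (pin_xi S))"
    using U by blast
qed

text \<open>Since H is an involution, the inverse g also lies over H, and the same smoothness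
  argument applies to it.\<close>

lemma pin_diffeo_over:
  assumes cov: "two_fold_covering (pin_total S) (frames frames_T2) (pin_xi S)"
      "two_fold_covering (pin_total S') (frames frames_T2) (pin_xi S')"
    and fg: "homeomorphic_maps (pin_total S) (pin_total S') f g"
    and over: "\<And>p. p \<in> topspace (pin_total S) \<Longrightarrow> pin_xi S' (f p) = H (pin_xi S p)"
    and H: "H = id \<or> H = dtau"
  shows "pin_diffeo S S' f"
proof -
  have HH: "H (H x) = x" for x using H by (auto simp: dtau_dtau)
  have "pin_xi S (g q) = H (pin_xi S' q)" if "q \<in> topspace (pin_total S')" for q
  proof -
    have "g q \<in> topspace (pin_total S)" "f (g q) = q"
      using fg that by (auto simp: homeomorphic_maps_def continuous_map_def)
    then show ?thesis using over[of "g q"] HH by metis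
  qed
  then show ?thesis
    unfolding pin_diffeo_def using fg pin_smooth_over[OF cov(1) _ over H] pin_smooth_over[OF cov(2) _ _ H]
    by (intro exI[of _ g]) (auto simp: homeomorphic_maps_def)
qed

section \<open>Twisted pin structures on the torus\<close>

lemma twisted_pin_simps [simp]:
  "pin_total (twisted_pin e R) = top_of_set (UNIV \<times> pin_set e)"
  "pin_act (twisted_pin e R) (x, p) s = (x, cl_mult e p s)"
  "pin_base (twisted_pin e R) = fst"
  "pin_xi (twisted_pin e R) (x, p) = (x, R x ** pin_cover e p)"
  using prod_topology_subtopology_eu[of "UNIV :: torus set" "pin_set e"] by (simp_all add: twisted_pin_def)

lemma continuous_transpose: "continuous_on UNIV (transpose :: real^2^2 \<Rightarrow> real^2^2)"
  by (rule continuous_on_mat2I) (simp add: transpose_def, intro continuous_intros)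

lemma involution_image:
  assumes "\<And>z. s (s z) = z"
  shows "s ` V = s -` V"
proof (intro equalityI subsetI)
  fix z assume "z \<in> s -` V"
  then have "s z \<in> V" by simp
  then have "s (s z) \<in> s ` V" by (rule imageI)
  then show "z \<in> s ` V" by (simp add: assms)
qed (auto simp: assms)

lemma cl_mult_scaleR [simp]:
  "cl_mult e (r *\<^sub>R s) t = r *\<^sub>R cl_mult e s t" "cl_mult e s (r *\<^sub>R t) = r *\<^sub>R cl_mult e s t"
  by (cases s; cases t; simp add: algebra_simps)+

declare cl_mult.simps [simp del]

text \<open>All four structures share total space and action and differ only in the matrix field R,
  so continuity and orthogonality of R carry the common argument.\<close>

locale twist =
  fixes e :: real and R :: "torus \<Rightarrow> real^2^2"
  assumes e: "e * e = 1"
    and continuous_R: "continuous_on UNIV R"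
    and orthogonal_R: "orthogonal_matrix (R x)"
begin

abbreviation S where "S \<equiv> twisted_pin e R"
abbreviation P where "P \<equiv> top_of_set (UNIV \<times> pin_set e) :: (torus \<times> cl2) topology"

lemma continuous_act: "continuous_map (prod_topology P (top_of_set (pin_set e))) P (\<lambda>(p, s). pin_act S p s)"
proof -
  have "continuous_on ((UNIV \<times> pin_set e) \<times> pin_set e)
      (\<lambda>z. (fst (fst z), cl_mult e (snd (fst z)) (snd z)) :: torus \<times> cl2)"
    by (intro continuous_intros)
  then have "continuous_on ((UNIV \<times> pin_set e) \<times> pin_set e) (\<lambda>((x, p), s). (x, cl_mult e p s) :: torus \<times> cl2)"
    by (simp add: case_prod_beta)
  then show ?thesis
    by (auto simp: continuous_map_in_subtopology case_prod_beta pin_set_mult[OF e] twisted_pin_def)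
qed

text \<open>The inverse multiplies by the transpose in each fibre. Hence a twisted structure is the
  product covering followed by a homeomorphism of the frame bundle.\<close>

lemma homeomorphic_map_rotate:
  "homeomorphic_map (frames frames_T2) (frames frames_T2) (\<lambda>(x, A). (x, R x ** A))"
proof -
  have tr: "transpose (R x) ** R x = mat 1" "R x ** transpose (R x) = mat 1" for x
    using orthogonal_R[of x] by (auto simp: orthogonal_matrix_def)
  have c: "continuous_on (UNIV \<times> O2) (\<lambda>z::tpair. (fst z, R (fst z) ** snd z))"
    "continuous_on (UNIV \<times> O2) (\<lambda>z::tpair. (fst z, transpose (R (fst z)) ** snd z))"
    by (intro continuous_intros continuous_on_compose2[OF continuous_R]
        continuous_on_compose2[OF continuous_transpose]; simp)+
  have "homeomorphic_maps (frames frames_T2) (frames frames_T2) (\<lambda>z. (fst z, R (fst z) ** snd z))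
     (\<lambda>z. (fst z, transpose (R (fst z)) ** snd z))"
    unfolding homeomorphic_maps_def
    using c by (auto simp: continuous_map_in_subtopology matrix_mul_assoc tr orthogonal_matrix_mul
        orthogonal_R orthogonal_matrix_transpose)
  then show ?thesis unfolding homeomorphic_map_maps case_prod_beta by blast
qed

lemma xi_decomp: "pin_xi S = (\<lambda>(x, A). (x, R x ** A)) \<circ> (\<lambda>(x, p). (x, pin_cover e p))"
  by (simp add: fun_eq_iff)

lemma open_map_xi: "open_map P (frames frames_T2) (pin_xi S)"
proof -
  have "open_map (prod_topology euclidean (top_of_set (pin_set e)))
      (prod_topology euclidean (top_of_set O2)) (\<lambda>(x::torus, p). (x, pin_cover e p))"
    by (intro open_map_prod open_map_pin_cover e) (simp add: open_map_def)
  then have "open_map P (frames frames_T2) (\<lambda>(x, p). (x, pin_cover e p))"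
    using prod_topology_subtopology_eu[of "UNIV :: torus set" "pin_set e"] prod_topology_subtopology_eu[of "UNIV :: torus set" O2] by simp
  then show ?thesis
    unfolding xi_decomp
    by (rule open_map_compose[OF _ homeomorphic_imp_open_map[OF homeomorphic_map_rotate]])
qed

lemma continuous_xi: "continuous_map P (frames frames_T2) (pin_xi S)"
proof -
  have "continuous_on (UNIV \<times> pin_set e) (\<lambda>z. (fst z, pin_cover e (snd z)) :: tpair)"
    by (intro continuous_intros continuous_on_compose2[OF continuous_on_pin_cover[OF e]]) auto
  then have "continuous_map P (frames frames_T2) (\<lambda>(x, p). (x, pin_cover e p))"
    by (auto simp: continuous_map_in_subtopology case_prod_beta pin_cover_orthogonal[OF e])
  then show ?thesis
    unfolding xi_decomp
    by (rule continuous_map_compose[OF _ homeomorphic_imp_continuous_map[OF homeomorphic_map_rotate]])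
qed

lemma xi_eq_iff:
  assumes "p \<in> pin_set e" "p' \<in> pin_set e"
  shows "pin_xi S (x, p) = pin_xi S (x', p') \<longleftrightarrow> x' = x \<and> (p' = p \<or> p' = - p)"
proof -
  have "transpose (R x) ** R x = mat 1"
    using orthogonal_R[of x] by (auto simp: orthogonal_matrix_def)
  then have "R x ** A = R x ** B \<longleftrightarrow> A = B" for A B
    by (metis matrix_mul_assoc matrix_mul_lid)
  then show ?thesis using pin_cover_eq_iff[OF e assms] by auto
qed

lemma xi_image: "pin_xi S ` (UNIV \<times> pin_set e) = UNIV \<times> O2"
proof -
  have "pin_xi S ` (UNIV \<times> pin_set e)
      = (\<lambda>(x, A). (x, R x ** A)) ` ((\<lambda>(x, p). (x, pin_cover e p)) ` (UNIV \<times> pin_set e))"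
    unfolding xi_decomp image_comp ..
  also have "(\<lambda>(x, p). (x, pin_cover e p)) ` (UNIV \<times> pin_set e) = UNIV \<times> O2"
    unfolding image_paired_Times pin_cover_image[OF e] by simp
  also have "(\<lambda>(x, A). (x, R x ** A)) ` (UNIV \<times> O2) = UNIV \<times> O2"
    using homeomorphic_imp_surjective_map[OF homeomorphic_map_rotate] by simp
  finally show ?thesis .
qed

text \<open>The open half space around s contains no antipodal pair; it supplies the sets displaced
  by the sheet exchange.\<close>

lemma pin_half_sphere:
  assumes "s \<in> pin_set e"
  obtains H where "open H" "s \<in> H" "\<And>t. t \<in> H \<Longrightarrow> - t \<notin> H"
proof -
  have "open {t. 0 < t \<bullet> s}" by (intro open_Collect_less continuous_intros)
  then show ?thesis using pin_set_inner_self[OF e assms] that[of "{t. 0 < t \<bullet> s}"] by auto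
qed

lemma two_fold_covering_xi: "two_fold_covering P (frames frames_T2) (pin_xi S)"
proof (rule two_fold_coveringI)
  let ?\<sigma> = "\<lambda>(x, p). (x :: torus, - p :: cl2)"
  show "pin_xi S ` topspace P = topspace (frames frames_T2)" using xi_image by simp
  show "pin_xi S p = pin_xi S p' \<longleftrightarrow> p' = p \<or> p' = ?\<sigma> p"
    if "p \<in> topspace P" "p' \<in> topspace P" for p p'
    using that xi_eq_iff by (cases p; cases p') auto
  show "openin P (?\<sigma> ` U)" if "openin P U" for U
  proof -
    obtain T where T: "open T" "U = (UNIV \<times> pin_set e) \<inter> T" using \<open>openin P U\<close> by (auto simp: openin_open)
    have im: "?\<sigma> ` V = ?\<sigma> -` V" for V by (rule involution_image) auto
    have "continuous_on UNIV ?\<sigma>" unfolding case_prod_beta by (intro continuous_intros)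
    then have "open (?\<sigma> -` T)" using T by (simp add: continuous_on_open_vimage)
    moreover have "?\<sigma> ` U = (UNIV \<times> pin_set e) \<inter> (?\<sigma> -` T)"
      unfolding im T(2) by (simp add: set_eq_iff e)
    ultimately show ?thesis by (auto simp: openin_open)
  qed
  show "\<exists>U. openin P U \<and> p \<in> U \<and> disjnt U (?\<sigma> ` U)" if pP: "p \<in> topspace P" for p
  proof -
    have "snd p \<in> pin_set e" using pP by auto
    then obtain H where H: "open H" "snd p \<in> H" "\<And>t. t \<in> H \<Longrightarrow> - t \<notin> H"
      by (rule pin_half_sphere) blast
    have "openin P ((UNIV \<times> pin_set e) \<inter> (UNIV \<times> H))"
      by (intro openin_open_Int open_Times open_UNIV H)
    moreover have "p \<in> (UNIV \<times> pin_set e) \<inter> (UNIV \<times> H)"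
      using H(2) pP by (simp add: mem_Times_iff)
    moreover have "disjnt ((UNIV \<times> pin_set e) \<inter> (UNIV \<times> H)) (?\<sigma> ` ((UNIV \<times> pin_set e) \<inter> (UNIV \<times> H)))"
      unfolding disjnt_iff
    proof (intro allI notI, elim conjE imageE)
      fix z w assume "z \<in> (UNIV \<times> pin_set e) \<inter> (UNIV \<times> H)" "z = ?\<sigma> w"
        "w \<in> (UNIV \<times> pin_set e) \<inter> (UNIV \<times> H)"
      then have "snd z = - snd w" "snd z \<in> H" "snd w \<in> H"
        by (simp_all add: case_prod_beta mem_Times_iff)
      then show False using H(3)[of "snd w"] by simp
    qed
    ultimately show ?thesis by blast
  qed
qed (use open_map_xi continuous_xi in auto)

text \<open>The total space is a product, so the identity is a trivialization over the whole
  torus.\<close>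

lemma principal_bundle_twisted: "principal_bundle (pin_group e) P (pin_act S) fst"
  unfolding principal_bundle_def
proof (intro conjI allI)
  show "continuous_map (prod_topology P (top_of_set (carrier (pin_group e)))) P (\<lambda>(p, s). pin_act S p s)"
    using continuous_act by simp
  fix b :: torus
  have "homeomorphic_map P P (\<lambda>z. z)" using homeomorphic_map_id[of P P] by (simp add: id_def)
  moreover have "{p \<in> topspace P. fst p \<in> UNIV} = topspace P" by simp
  ultimately have "homeomorphic_map (prod_topology (top_of_set UNIV) (top_of_set (carrier (pin_group e))))
     (subtopology P {p \<in> topspace P. fst p \<in> UNIV}) (\<lambda>z. z)"
    using prod_topology_subtopology_eu[of "UNIV :: torus set" "pin_set e"] subtopology_topspace[of P] by simp
  then show "\<exists>U \<Phi>. open U \<and> b \<in> U \<and>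
        homeomorphic_map (prod_topology (top_of_set U) (top_of_set (carrier (pin_group e))))
          (subtopology P {p \<in> topspace P. fst p \<in> U}) \<Phi> \<and>
        (\<forall>x\<in>U. \<forall>g\<in>carrier (pin_group e). fst (\<Phi> (x, g)) = x) \<and>
        (\<forall>x\<in>U. \<forall>g\<in>carrier (pin_group e). \<forall>h\<in>carrier (pin_group e).
            \<Phi> (x, g \<otimes>\<^bsub>pin_group e\<^esub> h) = pin_act S (\<Phi> (x, g)) h)"
    by (intro exI[of _ UNIV] exI[of _ "\<lambda>z. z"]) simp
qed (auto simp: cl_mult_assoc[OF e] continuous_on_fst intro: continuous_intros)

lemma pin_structure_twisted: "pin_structure e frames_T2 S"
  unfolding pin_structure_def
  using principal_bundle_twisted two_fold_covering_xi
  by (auto simp: pin_cover_mult[OF e] matrix_mul_assoc)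

end

section \<open>Lifts of the differential of the involution\<close>

text \<open>The lifts of \<open>dtau\<close> are \<open>(x, p) \<mapsto> (tau x, \<plusminus> q x p)\<close>, where \<open>q\<close> is a continuous lift to
  the pin group of \<open>x \<mapsto> R (tau x)\<^sup>-\<^sup>1 j2 R x\<close>. Their common square is the multiplication
  with \<open>q (tau x) (q x) = \<delta>\<close>.\<close>

locale twist_lift = twist +
  fixes q :: "torus \<Rightarrow> cl2" and \<delta> :: real
  assumes continuous_q: "continuous_on UNIV q"
    and q_pin: "q x \<in> pin_set e"
    and q_cover: "R (tau x) ** pin_cover e (q x) = j2 ** R x"
    and q_square: "cl_mult e (q (tau x)) (q x) = \<delta> *\<^sub>R cl_one"
    and \<delta>: "\<delta> = 1 \<or> \<delta> = - 1"
begin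

definition L :: "torus \<times> cl2 \<Rightarrow> torus \<times> cl2" where
  "L = (\<lambda>(x, p). (tau x, cl_mult e (q x) p))"

lemma L_closed: "z \<in> UNIV \<times> pin_set e \<Longrightarrow> L z \<in> UNIV \<times> pin_set e"
  by (auto simp: L_def q_pin intro: pin_set_mult[OF e])

lemma L_L: "L (L (x, p)) = (x, \<delta> *\<^sub>R p)"
  by (simp add: L_def tau_tau cl_mult_assoc[OF e, symmetric] q_square)

lemma L_act: "L (pin_act S z s) = pin_act S (L z) s"
  by (cases z) (simp add: L_def cl_mult_assoc[OF e])

lemma xi_L: "z \<in> UNIV \<times> pin_set e \<Longrightarrow> pin_xi S (L z) = dtau (pin_xi S z)"
  by (cases z) (auto simp: L_def dtau_def pin_cover_mult[OF e q_pin] matrix_mul_assoc q_cover)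

lemma continuous_on_L: "continuous_on UNIV L"
  unfolding L_def case_prod_beta
  by (intro continuous_intros continuous_on_compose2[OF continuous_tau]
      continuous_on_compose2[OF continuous_q]) auto

text \<open>L commutes with the scalar \<open>\<delta>\<close> and squares to it, so L followed or
  preceded by \<open>\<delta>\<close> is its inverse.\<close>

lemma homeomorphic_maps_L: "homeomorphic_maps P P L (\<lambda>z. L (fst z, \<delta> *\<^sub>R snd z))"
proof -
  have dp: "\<delta> *\<^sub>R p \<in> pin_set e" if "p \<in> pin_set e" for p
    using \<delta> that by (auto simp: e)
  have "continuous_on UNIV (\<lambda>z. L (fst z, \<delta> *\<^sub>R snd z))"
    by (intro continuous_on_compose2[OF continuous_on_L] continuous_intros) auto
  then have "continuous_map P P (\<lambda>z. L (fst z, \<delta> *\<^sub>R snd z))"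
    using L_closed dp by (auto simp: continuous_map_in_subtopology mem_Times_iff intro: continuous_on_subset)
  moreover have "continuous_map P P L"
    using L_closed continuous_on_L by (auto simp: continuous_map_in_subtopology intro: continuous_on_subset)
  moreover have "\<delta> * \<delta> = 1" using \<delta> by auto
  then have "L (fst (L z), \<delta> *\<^sub>R snd (L z)) = z \<and> L (L (fst z, \<delta> *\<^sub>R snd z)) = z" for z
    by (cases z) (auto simp: L_def tau_tau cl_mult_assoc[OF e, symmetric] q_square)
  ultimately show ?thesis by (simp add: homeomorphic_maps_def)
qed

lemma is_lift_L: "is_lift e dtau S L"
  unfolding is_lift_def pin_equivariant_def
  using pin_diffeo_over[of S S L "\<lambda>z. L (fst z, \<delta> *\<^sub>R snd z)" dtau]
    two_fold_covering_xi homeomorphic_maps_L xi_L L_act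
  by simp

text \<open>By equivariance M is determined on the section of identity elements, where it agrees
  with L up to a sign. The sign is constant and squares to 1, so M and L have the same square. This
  form also covers the lift transported from a pull-back.\<close>

lemma lift_square:
  assumes cont: "continuous_map P P M" and equiv: "pin_equivariant e S S M"
    and over: "\<And>z. z \<in> topspace P \<Longrightarrow> pin_xi S (M z) = dtau (pin_xi S z)"
    and z: "z \<in> UNIV \<times> pin_set e"
  shows "M (M z) = (fst z, \<delta> *\<^sub>R snd z)"
proof -
  define m where "m = (\<lambda>x. snd (M (x, cl_one)))"
  have one: "(x, cl_one) \<in> UNIV \<times> pin_set e" for x :: torus by (simp add: pin_set.one)
  have MP: "M (x, cl_one) \<in> UNIV \<times> pin_set e" for x
    using continuous_map_image_subset_topspace[OF cont] one[of x] by auto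
  have m_pin: "m x \<in> pin_set e" for x using MP[of x] by (auto simp: m_def)
  have xiM: "pin_xi S (M (x, cl_one)) = pin_xi S (L (x, cl_one))" for x
    using over[of "(x, cl_one)"] one[of x] xi_L[OF one, of x] by simp
  have Mx: "M (x, cl_one) = (fst (M (x, cl_one)), m x)" for x by (simp add: m_def)
  have m: "fst (M (x, cl_one)) = tau x \<and> (m x = q x \<or> m x = - q x)" for x
  proof -
    have "tau x = fst (M (x, cl_one)) \<and> (q x = m x \<or> q x = - m x)"
      using xi_eq_iff[OF m_pin q_pin, of "fst (M (x, cl_one))" x "tau x" x] xiM[of x] Mx[of x]
      by (simp add: L_def)
    then show ?thesis by auto
  qed
  \<comment> \<open>The inner product extracts the sign between two unit vectors as a continuous
    function.\<close>
  define h where "h = (\<lambda>x. m x \<bullet> q x)"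
  have hq: "m x = h x *\<^sub>R q x \<and> h x \<in> {1, - 1}" for x
    using m[of x] pin_set_inner_self[OF e q_pin[of x]] by (auto simp: h_def)
  have "continuous_on (UNIV \<times> pin_set e) M" using cont by (simp add: continuous_map_in_subtopology)
  then have "continuous_on UNIV (\<lambda>x. M (x, cl_one))"
    by (rule continuous_on_compose2) (use one in \<open>auto intro!: continuous_intros\<close>)
  then have "continuous_on UNIV h"
    unfolding h_def m_def by (intro continuous_intros continuous_q)
  then have "connected (range h)" using connected_torus by (rule connected_continuous_image)
  moreover have "range h \<subseteq> {1, - 1}" using hq by auto
  ultimately have "\<exists>a. range h \<subseteq> {a}"
    by (metis connected_finite_iff_sing finite.emptyI finite.insertI finite_subset order_refl subset_insertI)
  then obtain a where a: "h x = a" for x by (metis insertE empty_iff rangeI subsetD)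
  have aa: "a * a = 1" using hq[of undefined] a by auto
  have M: "M (x, p) = (tau x, a *\<^sub>R cl_mult e (q x) p)" if "p \<in> pin_set e" for x p
  proof -
    have "M (pin_act S (x, cl_one) p) = pin_act S (M (x, cl_one)) p"
      using equiv[unfolded pin_equivariant_def, rule_format, of "(x, cl_one)" p] that one[of x] by simp
    then show ?thesis using Mx[of x] m[of x] hq[of x] a by simp
  qed
  obtain x p where xp: "z = (x, p)" "p \<in> pin_set e" using z by auto
  \<comment> \<open>The fibre coordinate after one application of M must again lie in the group
    before the formula for M can be applied a second time.\<close>
  have "a *\<^sub>R cl_mult e (q x) p \<in> pin_set e"
    using pin_set_mult[OF e xp(2) q_pin[of x]] hq[of x] a by (auto simp: e)
  then show ?thesis
    using M[OF xp(2)] M[of "a *\<^sub>R cl_mult e (q x) p" "tau x"] xp aa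
    by (simp add: tau_tau cl_mult_assoc[OF e, symmetric] q_square)
qed

lemma lift_squares:
  assumes "is_lift e dtau S M"
  shows "\<delta> = 1 \<Longrightarrow> squares_to_id S M" "\<delta> = - 1 \<Longrightarrow> squares_to_exchange S M"
proof -
  have "M (M z) = (fst z, \<delta> *\<^sub>R snd z)" if "z \<in> topspace P" for z
    using assms that
    by (intro lift_square) (auto simp: is_lift_def pin_diffeo_def homeomorphic_maps_def)
  then show "\<delta> = 1 \<Longrightarrow> squares_to_id S M" "\<delta> = - 1 \<Longrightarrow> squares_to_exchange S M"
    by (auto simp: squares_to_id_def squares_to_exchange_def sheet_exchange_def)
qed

end

section \<open>Pull-backs\<close>

text \<open>The identification used inside \<open>pull_back\<close>: the frame at the torus point x
  representing the class k.\<close>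

definition frame_at :: "kpair \<Rightarrow> torus \<Rightarrow> tpair" where
  "frame_at k x = inv_into (UNIV \<times> O2) (\<lambda>f. (dpi f, fst f)) (k, x)"

lemma kpair_base_dpi [simp]: "kpair_base (dpi f) = klein_pi (fst f)"
  by (rule kpair_base.abs_eq)

lemma kpair_act_dpi [simp]: "kpair_act (dpi (x, A)) B = dpi (x, A ** B)"
  by (simp add: kpair_act.abs_eq)

lemma dpi_dtau [simp]: "dpi (dtau f) = dpi f"
  using dpi_eq_iff[of f "dtau f"] by auto

lemma klein_pi_tau [simp]: "klein_pi (tau x) = klein_pi x"
  using klein_pi_eq_iff[of x "tau x"] by auto

text \<open>The representatives f and \<open>dtau f\<close> of a class have base points x and
  \<open>tau x\<close>. These differ, so the base point selects one representative.\<close>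

lemma frame_at_dpi: "f \<in> UNIV \<times> O2 \<Longrightarrow> frame_at (dpi f) (fst f) = f"
proof -
  have "inj_on (\<lambda>f. (dpi f, fst f)) (UNIV \<times> O2)"
  proof (rule inj_onI)
    fix f g assume "(dpi f, fst f) = (dpi g, fst g)"
    then have "g = f \<or> g = dtau f" "fst f = fst g" using dpi_eq_iff by auto
    then show "f = g" using fst_dtau[of f] tau_neq[of "fst f"] by metis
  qed
  then show "f \<in> UNIV \<times> O2 \<Longrightarrow> frame_at (dpi f) (fst f) = f"
    unfolding frame_at_def by (rule inv_into_f_f)
qed

lemma frame_at:
  assumes k: "k \<in> dpi ` (UNIV \<times> O2)" and base: "klein_pi x = kpair_base k"
  shows "frame_at k x \<in> UNIV \<times> O2" "dpi (frame_at k x) = k" "fst (frame_at k x) = x"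
proof -
  obtain f where f: "f \<in> UNIV \<times> O2" "k = dpi f" using k by blast
  have "fst f = x \<or> fst f = tau x" using base f(2) klein_pi_eq_iff by simp
  then obtain g where "g \<in> UNIV \<times> O2" "k = dpi g" "fst g = x"
    using f dtau_frame_iff[of f] fst_dtau[of f] dpi_dtau[of f] tau_tau[of x] by metis
  then show "frame_at k x \<in> UNIV \<times> O2" "dpi (frame_at k x) = k" "fst (frame_at k x) = x"
    using frame_at_dpi[of g] by auto
qed

section \<open>The pull-back of a pin structure as a pin structure on the torus\<close>

locale klein_pin =
  fixes e :: real and Q :: "('q, klein, kpair) pin_bundle"
  assumes e: "e * e = 1" and Q: "pin_structure e frames_K2 Q"
begin

abbreviation PB where "PB \<equiv> pull_back Q"
abbreviation B where "B \<equiv> pin_total PB"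

lemma total_PB: "B = subtopology (prod_topology euclidean (pin_total Q)) {(x, q). klein_pi x = pin_base Q q}"
  by (simp add: pull_back_def)

lemma PB_simps [simp]:
  "pin_act PB (x, q) s = (x, pin_act Q q s)" "pin_base PB = fst"
  "pin_xi PB (x, q) = frame_at (pin_xi Q q) x"
  by (simp_all add: pull_back_def frame_at_def)

lemma topspace_B: "topspace B = {(x, q). q \<in> topspace (pin_total Q) \<and> klein_pi x = pin_base Q q}"
  by (auto simp: total_PB)

lemma Q_bundle: "principal_bundle (pin_group e) (pin_total Q) (pin_act Q) (pin_base Q)"
  and Q_cover: "two_fold_covering (pin_total Q) (frames frames_K2) (pin_xi Q)"
  and Q_base: "q \<in> topspace (pin_total Q) \<Longrightarrow> pin_base Q q = kpair_base (pin_xi Q q)"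
  and Q_equivariant: "q \<in> topspace (pin_total Q) \<Longrightarrow> s \<in> pin_set e \<Longrightarrow>
        pin_xi Q (pin_act Q q s) = kpair_act (pin_xi Q q) (pin_cover e s)"
  using Q by (auto simp: pin_structure_def)

lemma Q_continuous: "continuous_map (pin_total Q) (frames frames_K2) (pin_xi Q)"
  using Q_cover by (simp add: two_fold_covering_def)

lemma Q_xi: "q \<in> topspace (pin_total Q) \<Longrightarrow> pin_xi Q q \<in> dpi ` (UNIV \<times> O2)"
  using continuous_map_image_subset_topspace[OF Q_continuous] by auto

lemma xi_PB:
  assumes "(x, q) \<in> topspace B"
  shows "pin_xi PB (x, q) \<in> UNIV \<times> O2" "dpi (pin_xi PB (x, q)) = pin_xi Q q" "fst (pin_xi PB (x, q)) = x"
  using assms frame_at[OF Q_xi, of q x] Q_base[of q] by (auto simp: topspace_B)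

lemma continuous_fst_B: "continuous_map B euclidean fst"
  unfolding total_PB by (rule continuous_map_subtopology_fst)

lemma continuous_snd_B: "continuous_map B (pin_total Q) snd"
  unfolding total_PB by (rule continuous_map_subtopology_snd)

text \<open>Continuity is checked over a displaced set W. There a frame is recovered from its class
  and base point, and membership in T becomes membership of the class in the open set
  \<open>dpi\<close> of T over W.\<close>

lemma continuous_xi_PB: "continuous_map B (frames frames_T2) (pin_xi PB)"
  unfolding continuous_map_def
proof (intro conjI allI impI)
  show "pin_xi PB \<in> topspace B \<rightarrow> topspace (frames frames_T2)" using xi_PB(1) by auto
  fix T assume T: "openin (frames frames_T2) T"
  show "openin B {z \<in> topspace B. pin_xi PB z \<in> T}"
  proof (subst openin_subopen, intro ballI)
    fix z assume "z \<in> {z \<in> topspace B. pin_xi PB z \<in> T}"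
    then obtain x q where z: "z = (x, q)" "(x, q) \<in> topspace B" "pin_xi PB (x, q) \<in> T" by (cases z) auto
    obtain W where W: "open W" "x \<in> W" "\<And>y. y \<in> W \<Longrightarrow> tau y \<notin> W"
      by (rule tau_displaces[of x]) blast
    let ?T = "T \<inter> (W \<times> UNIV)"
    have "openin (frames frames_T2) ?T"
      using T open_Times[OF W(1) open_UNIV] by (auto simp: openin_open)
    then have G: "openin (frames frames_K2) (dpi ` ?T)" using open_map_dpi by (simp add: open_map_def)
    let ?N = "{w \<in> topspace B. fst w \<in> W} \<inter> {w \<in> topspace B. (pin_xi Q \<circ> snd) w \<in> dpi ` ?T}"
    have "openin B ?N"
      by (intro openin_Int openin_continuous_map_preimage[OF continuous_fst_B]
          openin_continuous_map_preimage[OF continuous_map_compose[OF continuous_snd_B Q_continuous] G])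
        (simp add: W(1))
    moreover have "pin_xi PB (x, q) \<in> ?T"
      using z W(2) xi_PB(3)[OF z(2)] by (simp add: mem_Times_iff del: PB_simps)
    then have "pin_xi Q q \<in> dpi ` ?T" using xi_PB(2)[OF z(2)] by (metis imageI)
    then have "z \<in> ?N" using z W(2) by simp
    moreover have "w \<in> {z \<in> topspace B. pin_xi PB z \<in> T}" if w: "w \<in> ?N" for w
    proof -
      obtain y r where yr: "w = (y, r)" by (cases w)
      have "(y, r) \<in> topspace B" "y \<in> W" "pin_xi Q r \<in> dpi ` ?T" using w by (auto simp: yr)
      moreover from this(3) obtain f where f: "f \<in> T" "fst f \<in> W" "pin_xi Q r = dpi f" by auto
      moreover have fF: "f \<in> UNIV \<times> O2" using f(1) openin_subset[OF T] by auto
      ultimately have "klein_pi y = klein_pi (fst f)" using Q_base[of r] by (simp add: topspace_B)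
      \<comment> \<open>Both points lie in W, which \<open>tau\<close> moves off itself, so equal
        classes in the Klein bottle force equal points.\<close>
      then have "y = fst f" using klein_pi_eq_iff[of "fst f" y] W(3) f(2) \<open>y \<in> W\<close> by metis
      then have "pin_xi PB (y, r) = f" using f(3) frame_at_dpi[OF fF] by simp
      then show ?thesis using \<open>(y, r) \<in> topspace B\<close> f(1) by (simp add: yr del: PB_simps)
    qed
    ultimately show "\<exists>S. openin B S \<and> z \<in> S \<and> S \<subseteq> {z \<in> topspace B. pin_xi PB z \<in> T}" by blast
  qed
qed

text \<open>With s the inverse of the covering on the sheet U, the inverse on the pulled-back sheet
  is f to (fst f, s (dpi f)).\<close>

lemma homeomorphic_map_sheet:
  assumes U: "openin (pin_total Q) U" and V: "openin (frames frames_K2) V"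
    and hom: "homeomorphic_map (subtopology (pin_total Q) U) (subtopology (frames frames_K2) V) (pin_xi Q)"
  shows "homeomorphic_map (subtopology B {z \<in> topspace B. snd z \<in> U})
    (subtopology (frames frames_T2) {f \<in> topspace (frames frames_T2). dpi f \<in> V}) (pin_xi PB)"
proof -
  let ?U = "{z \<in> topspace B. snd z \<in> U}" and ?V = "{f \<in> topspace (frames frames_T2). dpi f \<in> V}"
  obtain s where s: "homeomorphic_maps (subtopology (pin_total Q) U) (subtopology (frames frames_K2) V) (pin_xi Q) s"
    using hom homeomorphic_map_maps by blast
  have US: "U \<subseteq> topspace (pin_total Q)" and VS: "V \<subseteq> topspace (frames frames_K2)"
    using openin_subset[OF U] openin_subset[OF V] by blast+
  have sV: "s k \<in> U" "pin_xi Q (s k) = k" if "k \<in> V" for k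
  proof -
    have k: "k \<in> topspace (subtopology (frames frames_K2) V)" using that VS by auto
    show "pin_xi Q (s k) = k" using s k by (simp add: homeomorphic_maps_def)
    have "s k \<in> topspace (subtopology (pin_total Q) U)"
      using s k unfolding homeomorphic_maps_def continuous_map_def by blast
    then show "s k \<in> U" by simp
  qed
  have sU: "pin_xi Q q \<in> V" "s (pin_xi Q q) = q" if "q \<in> U" for q
  proof -
    have q: "q \<in> topspace (subtopology (pin_total Q) U)" using that US by auto
    show "s (pin_xi Q q) = q" using s q by (simp add: homeomorphic_maps_def)
    have "pin_xi Q q \<in> topspace (subtopology (frames frames_K2) V)"
      using s q unfolding homeomorphic_maps_def continuous_map_def by blast
    then show "pin_xi Q q \<in> V" by simp
  qed
  have inB: "(fst f, s (dpi f)) \<in> topspace B" if "f \<in> ?V" for f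
    using that sV[of "dpi f"] US Q_base[of "s (dpi f)"] by (auto simp: topspace_B)
  have cs: "continuous_map (subtopology (frames frames_T2) ?V) (pin_total Q) (s \<circ> dpi)"
  proof (rule continuous_map_compose)
    show "continuous_map (subtopology (frames frames_T2) ?V) (subtopology (frames frames_K2) V) dpi"
      using continuous_map_dpi by (auto simp: continuous_map_in_subtopology continuous_map_from_subtopology)
    show "continuous_map (subtopology (frames frames_K2) V) (pin_total Q) s"
      using s by (simp add: homeomorphic_maps_def continuous_map_in_subtopology)
  qed
  have cf: "continuous_map (subtopology (frames frames_T2) ?V) euclidean fst"
    by (auto simp: subtopology_subtopology intro!: continuous_intros)
  have "homeomorphic_maps (subtopology B ?U) (subtopology (frames frames_T2) ?V) (pin_xi PB) (\<lambda>f. (fst f, s (dpi f)))"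
    unfolding homeomorphic_maps_def
  proof (intro conjI ballI)
    show "continuous_map (subtopology B ?U) (subtopology (frames frames_T2) ?V) (pin_xi PB)"
      using continuous_xi_PB xi_PB sU(1)
      by (auto simp: continuous_map_in_subtopology continuous_map_from_subtopology simp del: PB_simps)
    have "continuous_map (subtopology (frames frames_T2) ?V) B (\<lambda>f. (fst f, s (dpi f)))"
      unfolding total_PB continuous_map_in_subtopology continuous_map_paired
      using cf cs inB by (auto simp: o_def topspace_B)
    then show "continuous_map (subtopology (frames frames_T2) ?V) (subtopology B ?U) (\<lambda>f. (fst f, s (dpi f)))"
      using inB sV(1) by (auto simp: continuous_map_in_subtopology)
  next
    fix z assume z: "z \<in> topspace (subtopology B ?U)"
    obtain x q where xq: "z = (x, q)" by (cases z)
    have "(x, q) \<in> topspace B" "q \<in> U" using z by (auto simp: xq)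
    then show "(fst (pin_xi PB z), s (dpi (pin_xi PB z))) = z"
      using xi_PB(2,3)[of x q] sU(2) by (simp add: xq del: PB_simps)
  next
    fix f assume "f \<in> topspace (subtopology (frames frames_T2) ?V)"
    then show "pin_xi PB (fst f, s (dpi f)) = f" using sV frame_at_dpi by auto
  qed
  then show ?thesis using homeomorphic_map_maps by blast
qed

lemma two_fold_covering_PB: "two_fold_covering B (frames frames_T2) (pin_xi PB)"
  unfolding two_fold_covering_def
proof (intro conjI ballI continuous_xi_PB)
  fix f assume f: "f \<in> topspace (frames frames_T2)"
  then have "dpi f \<in> topspace (frames frames_K2)" by simp
  from Q_cover[unfolded two_fold_covering_def, THEN conjunct2, rule_format, OF this]
  obtain V \<U> where V\<U>: "openin (frames frames_K2) V \<and> dpi f \<in> V \<and>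
      card \<U> = 2 \<and> pairwise disjnt \<U> \<and> \<Union>\<U> = {p \<in> topspace (pin_total Q). pin_xi Q p \<in> V} \<and>
      (\<forall>U\<in>\<U>. openin (pin_total Q) U \<and>
        homeomorphic_map (subtopology (pin_total Q) U) (subtopology (frames frames_K2) V) (pin_xi Q))"
    by (elim exE) (rule that)
  then have V: "openin (frames frames_K2) V" "dpi f \<in> V"
    and U: "card \<U> = 2" "pairwise disjnt \<U>" "\<Union>\<U> = {p \<in> topspace (pin_total Q). pin_xi Q p \<in> V}"
    by simp_all
  have U4: "openin (pin_total Q) U"
    "homeomorphic_map (subtopology (pin_total Q) U) (subtopology (frames frames_K2) V) (pin_xi Q)"
    if "U \<in> \<U>" for U
    using V\<U> that by blast+
  let ?V = "{f \<in> topspace (frames frames_T2). dpi f \<in> V}"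
  let ?l = "\<lambda>U. {z \<in> topspace B. snd z \<in> U}"
  have disj: "disjnt (?l U) (?l U')" if "U \<in> \<U>" "U' \<in> \<U>" "U \<noteq> U'" for U U'
    using U(2) that by (auto simp: pairwise_def disjnt_iff)
  \<comment> \<open>Pulled-back sheets are disjoint; being nonempty as well, they stay distinct, so
    that there are still two of them.\<close>
  have ne: "?l U \<noteq> {}" if "U \<in> \<U>" for U
  proof -
    have "pin_xi Q ` U = V" by (rule sheet_image(1)[OF U4(1)[OF that] V(1) U4(2)[OF that]])
    then obtain u where u: "u \<in> U" "pin_xi Q u = dpi f" using V(2) by (metis imageE)
    have "u \<in> topspace (pin_total Q)" using u(1) openin_subset[OF U4(1)[OF that]] by blast
    then have "(fst f, u) \<in> ?l U" using u Q_base[of u] by (simp add: topspace_B)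
    then show ?thesis by blast
  qed
  have "inj_on ?l \<U>"
  proof (rule inj_onI, rule ccontr)
    fix U U' assume "U \<in> \<U>" "U' \<in> \<U>" "?l U = ?l U'" "U \<noteq> U'"
    then show False using disj[of U U'] ne[of U] by (auto simp: disjnt_def)
  qed
  then have "card (?l ` \<U>) = 2" using U(1) by (simp add: card_image)
  moreover have "pairwise disjnt (?l ` \<U>)" using disj by (auto simp: pairwise_def)
  moreover have "\<Union>(?l ` \<U>) = {z \<in> topspace B. pin_xi PB z \<in> ?V}"
  proof -
    have "(\<exists>U\<in>\<U>. snd z \<in> U) \<longleftrightarrow> pin_xi PB z \<in> ?V" if z: "z \<in> topspace B" for z
    proof -
      obtain x q where xq: "z = (x, q)" by (cases z)
      have that: "(x, q) \<in> topspace B" using z xq by simp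
      then have "q \<in> topspace (pin_total Q)" by (simp add: topspace_B)
      then have "(\<exists>U\<in>\<U>. q \<in> U) \<longleftrightarrow> pin_xi Q q \<in> V" using U(3) by blast
      then show ?thesis using xi_PB[OF that] by (simp add: xq del: PB_simps)
    qed
    then show ?thesis by blast
  qed
  moreover have "openin (frames frames_T2) ?V"
    using openin_continuous_map_preimage[OF continuous_map_dpi V(1)] .
  moreover have "openin B (?l U) \<and> homeomorphic_map (subtopology B (?l U)) (subtopology (frames frames_T2) ?V) (pin_xi PB)"
    if "U \<in> \<U>" for U
    by (intro conjI openin_continuous_map_preimage[OF continuous_snd_B] homeomorphic_map_sheet V(1) U4 that)
  moreover have "f \<in> ?V" using f V(2) by simp
  ultimately show "\<exists>V \<U>. openin (frames frames_T2) V \<and> f \<in> V \<and> card \<U> = 2 \<and> pairwise disjnt \<U> \<and>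
       \<Union> \<U> = {p \<in> topspace B. pin_xi PB p \<in> V} \<and>
       (\<forall>U\<in>\<U>. openin B U \<and> homeomorphic_map (subtopology B U) (subtopology (frames frames_T2) V) (pin_xi PB))"
    by (intro exI[of _ ?V] exI[of _ "?l ` \<U>"]) blast
qed

lemma Q_act:
  assumes "q \<in> topspace (pin_total Q)" "s \<in> pin_set e"
  shows "pin_act Q q s \<in> topspace (pin_total Q)" "pin_base Q (pin_act Q q s) = pin_base Q q"
proof -
  have "continuous_map (prod_topology (pin_total Q) (top_of_set (pin_set e))) (pin_total Q) (\<lambda>(p, g). pin_act Q p g)"
    using Q_bundle by (simp add: principal_bundle_def)
  from continuous_map_image_subset_topspace[OF this]
  show "pin_act Q q s \<in> topspace (pin_total Q)" using assms by auto
  show "pin_base Q (pin_act Q q s) = pin_base Q q"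
    using Q_bundle assms by (simp add: principal_bundle_def)
qed

text \<open>A trivialization over U pulls back to one over the preimage of U: the base point is kept
  and the fibre coordinate is taken from the given trivialization.\<close>

lemma local_trivialization_PB:
  obtains U \<Phi> where "open U" "b \<in> U"
    "homeomorphic_map (prod_topology (top_of_set U) (top_of_set (pin_set e)))
       (subtopology B {p \<in> topspace B. fst p \<in> U}) \<Phi>"
    "\<And>x g. x \<in> U \<Longrightarrow> g \<in> pin_set e \<Longrightarrow> fst (\<Phi> (x, g)) = x"
    "\<And>x g h. x \<in> U \<Longrightarrow> g \<in> pin_set e \<Longrightarrow> h \<in> pin_set e \<Longrightarrow> \<Phi> (x, cl_mult e g h) = pin_act PB (\<Phi> (x, g)) h"
proof -
  have "\<exists>U \<Phi>. open U \<and> klein_pi b \<in> U \<and>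
        homeomorphic_map (prod_topology (top_of_set U) (top_of_set (pin_set e)))
          (subtopology (pin_total Q) {p \<in> topspace (pin_total Q). pin_base Q p \<in> U}) \<Phi> \<and>
        (\<forall>x\<in>U. \<forall>g\<in>pin_set e. pin_base Q (\<Phi> (x, g)) = x) \<and>
        (\<forall>x\<in>U. \<forall>g\<in>pin_set e. \<forall>h\<in>pin_set e. \<Phi> (x, cl_mult e g h) = pin_act Q (\<Phi> (x, g)) h)"
    using Q_bundle unfolding principal_bundle_def pin_group_simps by blast
  then obtain U \<Phi> where U: "open U" "klein_pi b \<in> U" and
    hom: "homeomorphic_map (prod_topology (top_of_set U) (top_of_set (pin_set e)))
          (subtopology (pin_total Q) {p \<in> topspace (pin_total Q). pin_base Q p \<in> U}) \<Phi>"
    and base: "\<And>x g. x \<in> U \<Longrightarrow> g \<in> pin_set e \<Longrightarrow> pin_base Q (\<Phi> (x, g)) = x"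
    and act: "\<And>x g h. x \<in> U \<Longrightarrow> g \<in> pin_set e \<Longrightarrow> h \<in> pin_set e \<Longrightarrow>
         \<Phi> (x, cl_mult e g h) = pin_act Q (\<Phi> (x, g)) h"
    by blast
  let ?QU = "subtopology (pin_total Q) {p \<in> topspace (pin_total Q). pin_base Q p \<in> U}"
  obtain \<Psi> where \<Psi>: "homeomorphic_maps (prod_topology (top_of_set U) (top_of_set (pin_set e))) ?QU \<Phi> \<Psi>"
    using hom homeomorphic_map_maps by blast
  have \<Phi>c: "continuous_map (top_of_set (U \<times> pin_set e)) ?QU \<Phi>"
    and \<Psi>c: "continuous_map ?QU (top_of_set (U \<times> pin_set e)) \<Psi>"
    and \<Psi>\<Phi>: "\<And>z. z \<in> U \<times> pin_set e \<Longrightarrow> \<Psi> (\<Phi> z) = z"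
    and \<Phi>\<Psi>: "\<And>q. q \<in> topspace ?QU \<Longrightarrow> \<Phi> (\<Psi> q) = q"
    using \<Psi> by (auto simp: homeomorphic_maps_def)
  have \<Phi>T: "\<Phi> (x, g) \<in> topspace (pin_total Q)" if "x \<in> U" "g \<in> pin_set e" for x g
    using continuous_map_image_subset_topspace[OF \<Phi>c] that by auto
  have \<Psi>T: "\<Psi> q \<in> U \<times> pin_set e" if "q \<in> topspace ?QU" for q
    using continuous_map_image_subset_topspace[OF \<Psi>c] that by auto
  have fst\<Psi>: "fst (\<Psi> q) = pin_base Q q" if "q \<in> topspace ?QU" for q
    using base[of "fst (\<Psi> q)" "snd (\<Psi> q)"] \<Psi>T[OF that] \<Phi>\<Psi>[OF that] by (simp add: mem_Times_iff)
  let ?U = "klein_pi -` U"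
  let ?BU = "subtopology B {p \<in> topspace B. fst p \<in> ?U}"
  let ?f = "\<lambda>z. (fst z, \<Phi> (klein_pi (fst z), snd z))" and ?g = "\<lambda>z. (fst z, snd (\<Psi> (snd z)))"
  have "homeomorphic_maps (top_of_set (?U \<times> pin_set e)) ?BU ?f ?g"
    unfolding homeomorphic_maps_def
  proof (intro conjI ballI)
    have "continuous_map (top_of_set (?U \<times> pin_set e)) (top_of_set (U \<times> pin_set e)) (\<lambda>z. (klein_pi (fst z), snd z))"
      by (auto simp: continuous_map_in_subtopology
          intro!: continuous_intros continuous_on_compose2[OF continuous_klein_pi])
    then have "continuous_map (top_of_set (?U \<times> pin_set e)) ?QU (\<Phi> \<circ> (\<lambda>z. (klein_pi (fst z), snd z)))"
      by (rule continuous_map_compose[OF _ \<Phi>c])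
    then have "continuous_map (top_of_set (?U \<times> pin_set e)) (pin_total Q) (\<lambda>z. \<Phi> (klein_pi (fst z), snd z))"
      by (simp add: continuous_map_in_subtopology o_def)
    then have "continuous_map (top_of_set (?U \<times> pin_set e)) B ?f"
      unfolding total_PB continuous_map_in_subtopology continuous_map_paired
      using base by (auto intro!: continuous_intros)
    then show "continuous_map (top_of_set (?U \<times> pin_set e)) ?BU ?f"
      using \<Phi>T base by (auto simp: continuous_map_in_subtopology topspace_B)
    have "continuous_map ?BU ?QU snd"
      using continuous_snd_B by (auto simp: continuous_map_in_subtopology continuous_map_from_subtopology topspace_B)
    then have "continuous_map ?BU (top_of_set (U \<times> pin_set e)) (\<Psi> \<circ> snd)"
      by (rule continuous_map_compose[OF _ \<Psi>c])
    then have "continuous_map ?BU euclidean (\<Psi> \<circ> snd)"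
      by (simp add: continuous_map_in_subtopology)
    then have "continuous_map ?BU euclidean (snd \<circ> (\<Psi> \<circ> snd))"
      by (rule continuous_map_compose) (auto intro: continuous_intros)
    moreover have "continuous_map ?BU euclidean fst"
      by (rule continuous_map_from_subtopology[OF continuous_fst_B])
    ultimately have "continuous_map ?BU (prod_topology euclidean euclidean) ?g"
      unfolding continuous_map_paired by (simp add: o_def)
    then show "continuous_map ?BU (top_of_set (?U \<times> pin_set e)) ?g"
      using \<Psi>T by (auto simp: continuous_map_in_subtopology topspace_B mem_Times_iff)
  next
    fix z assume "z \<in> topspace (top_of_set (?U \<times> pin_set e))"
    then show "?g (?f z) = z" using \<Psi>\<Phi> by (cases z) auto
  next
    fix z assume "z \<in> topspace ?BU"
    then show "?f (?g z) = z"
      using \<Phi>\<Psi>[of "snd z"] fst\<Psi>[of "snd z"] by (cases z) (auto simp: topspace_B, metis prod.collapse)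
  qed
  then have "homeomorphic_map (prod_topology (top_of_set ?U) (top_of_set (pin_set e))) ?BU ?f"
    using homeomorphic_map_maps by fastforce
  moreover have "open ?U" using U(1) by (simp add: open_klein_def)
  ultimately show ?thesis using U(2) act by (intro that[of ?U ?f]) auto
qed

lemma principal_bundle_PB: "principal_bundle (pin_group e) B (pin_act PB) (pin_base PB)"
  unfolding principal_bundle_def pin_group_simps
proof (intro conjI)
  let ?A = "prod_topology B (top_of_set (pin_set e))"
  have act: "continuous_map (prod_topology (pin_total Q) (top_of_set (pin_set e))) (pin_total Q) (\<lambda>(p, g). pin_act Q p g)"
    using Q_bundle by (simp add: principal_bundle_def)
  have c1: "continuous_map ?A euclidean (fst \<circ> fst)"
    by (rule continuous_map_compose[OF continuous_map_fst continuous_fst_B])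
  have "continuous_map ?A (pin_total Q) (snd \<circ> fst)"
    by (rule continuous_map_compose[OF continuous_map_fst continuous_snd_B])
  then have "continuous_map ?A (prod_topology (pin_total Q) (top_of_set (pin_set e))) (\<lambda>z. ((snd \<circ> fst) z, snd z))"
    by (intro continuous_map_pairedI continuous_map_snd)
  from continuous_map_compose[OF this act]
  have c2: "continuous_map ?A (pin_total Q) (\<lambda>z. pin_act Q (snd (fst z)) (snd z))" by (simp add: o_def)
  have "(\<lambda>(p, g). pin_act PB p g) = (\<lambda>z. ((fst \<circ> fst) z, pin_act Q (snd (fst z)) (snd z)))"
    by (simp add: fun_eq_iff)
  moreover have "continuous_map ?A B (\<lambda>z. ((fst \<circ> fst) z, pin_act Q (snd (fst z)) (snd z)))"
    unfolding total_PB continuous_map_in_subtopology continuous_map_paired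
    using c1 c2 Q_act(2) by (auto simp: total_PB[symmetric] topspace_B o_def)
  ultimately show "continuous_map ?A B (\<lambda>(p, g). pin_act PB p g)" by simp
  show "continuous_map B euclidean (pin_base PB)" using continuous_fst_B by simp
  show "\<forall>b. \<exists>U \<Phi>. open U \<and> b \<in> U \<and>
        homeomorphic_map (prod_topology (top_of_set U) (top_of_set (pin_set e)))
          (subtopology B {p \<in> topspace B. pin_base PB p \<in> U}) \<Phi> \<and>
        (\<forall>x\<in>U. \<forall>g\<in>pin_set e. pin_base PB (\<Phi> (x, g)) = x) \<and>
        (\<forall>x\<in>U. \<forall>g\<in>pin_set e. \<forall>h\<in>pin_set e. \<Phi> (x, cl_mult e g h) = pin_act PB (\<Phi> (x, g)) h)"
  proof
    fix b
    show "\<exists>U \<Phi>. open U \<and> b \<in> U \<and>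
        homeomorphic_map (prod_topology (top_of_set U) (top_of_set (pin_set e)))
          (subtopology B {p \<in> topspace B. pin_base PB p \<in> U}) \<Phi> \<and>
        (\<forall>x\<in>U. \<forall>g\<in>pin_set e. pin_base PB (\<Phi> (x, g)) = x) \<and>
        (\<forall>x\<in>U. \<forall>g\<in>pin_set e. \<forall>h\<in>pin_set e. \<Phi> (x, cl_mult e g h) = pin_act PB (\<Phi> (x, g)) h)"
    proof (rule local_trivialization_PB[of b])
      fix U \<Phi>
      assume *: "open U" "b \<in> U"
        "homeomorphic_map (prod_topology (top_of_set U) (top_of_set (pin_set e)))
          (subtopology B {p \<in> topspace B. fst p \<in> U}) \<Phi>"
        "\<And>x g. x \<in> U \<Longrightarrow> g \<in> pin_set e \<Longrightarrow> fst (\<Phi> (x, g)) = x"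
        "\<And>x g h. x \<in> U \<Longrightarrow> g \<in> pin_set e \<Longrightarrow> h \<in> pin_set e \<Longrightarrow> \<Phi> (x, cl_mult e g h) = pin_act PB (\<Phi> (x, g)) h"
      show ?thesis unfolding PB_simps(2) by (intro exI[of _ U] exI[of _ \<Phi>] conjI ballI *)
    qed
  qed
qed (use Q_bundle in \<open>auto simp: topspace_B principal_bundle_def\<close>)

lemma xi_PB_act:
  assumes z: "z \<in> topspace B" and s: "s \<in> pin_set e"
  shows "pin_xi PB (pin_act PB z s) = frame_act frames_T2 (pin_xi PB z) (pin_cover e s)"
proof -
  obtain x q where xq: "z = (x, q)" by (cases z)
  have zB: "(x, q) \<in> topspace B" using z xq by simp
  obtain y A where f: "pin_xi PB (x, q) = (y, A)" by (cases "pin_xi PB (x, q)")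
  have y: "y = x" and A: "orthogonal_matrix A" and q: "pin_xi Q q = dpi (x, A)"
    using xi_PB[OF zB] unfolding f by auto
  have "(x, A ** pin_cover e s) \<in> UNIV \<times> O2"
    using A pin_cover_orthogonal[OF e s] by (simp add: orthogonal_matrix_mul)
  then have "frame_at (dpi (x, A ** pin_cover e s)) x = (x, A ** pin_cover e s)"
    using frame_at_dpi by fastforce
  then have "pin_xi PB (pin_act PB z s) = (x, A ** pin_cover e s)"
    using Q_equivariant[of q s] zB s q by (simp add: xq topspace_B)
  then show ?thesis using f y by (simp add: xq)
qed

lemma pin_structure_PB: "pin_structure e frames_T2 PB"
  unfolding pin_structure_def
  using principal_bundle_PB two_fold_covering_PB xi_PB(3) xi_PB_act by auto

lemma homeomorphic_maps_swap: "homeomorphic_maps B B (\<lambda>(x, q). (tau x, q)) (\<lambda>(x, q). (tau x, q))"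
proof -
  have "continuous_map B euclidean (\<lambda>z. tau (fst z))"
    using continuous_map_compose[OF continuous_fst_B, of euclidean tau] continuous_tau by (simp add: o_def)
  then have "continuous_map B B (\<lambda>z. (tau (fst z), snd z))"
    unfolding total_PB continuous_map_in_subtopology continuous_map_paired
    using continuous_snd_B by (auto simp: total_PB[symmetric] topspace_B)
  then have "continuous_map B B (\<lambda>(x, q). (tau x, q))" unfolding case_prod_beta .
  then show ?thesis by (auto simp: homeomorphic_maps_def tau_tau)
qed

text \<open>The frame at x and its image under \<open>dtau\<close> at \<open>tau x\<close> represent
  the same class, so keeping q and exchanging the base points covers \<open>dtau\<close>.\<close>

lemma is_lift_swap: "is_lift e dtau PB (\<lambda>(x, q). (tau x, q))"
proof -
  have over: "pin_xi PB (case z of (x, q) \<Rightarrow> (tau x, q)) = dtau (pin_xi PB z)" if "z \<in> topspace B" for z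
  proof -
    obtain x q where xq: "z = (x, q)" by (cases z)
    have zB: "(x, q) \<in> topspace B" using that xq by simp
    have "dtau (pin_xi PB (x, q)) \<in> UNIV \<times> O2" using xi_PB(1)[OF zB] by (simp only: dtau_frame_iff)
    from frame_at_dpi[OF this] show ?thesis
      using xi_PB(2,3)[OF zB] by (simp add: xq)
  qed
  then have "pin_diffeo PB PB (\<lambda>(x, q). (tau x, q))"
    by (intro pin_diffeo_over[OF two_fold_covering_PB two_fold_covering_PB homeomorphic_maps_swap]) auto
  then show ?thesis using over by (auto simp: is_lift_def pin_equivariant_def)
qed

end

section \<open>Obstruction to being a pull-back\<close>

context twist_lift
begin

text \<open>An equivalence would conjugate the swap of the pull-back into a lift M on the torus
  structure with square the identity, whereas every such lift squares to the sheet exchange.\<close>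

lemma not_equivalent_pull_back:
  assumes \<delta>1: "\<delta> = - 1" and Q: "pin_structure e frames_K2 (Q :: ('q, klein, kpair) pin_bundle)"
  shows "\<not> pin_equivalent e S (pull_back Q)"
proof
  interpret Q: klein_pin e Q by unfold_locales (fact e, fact Q)
  let ?t = "\<lambda>(x, q). (tau x, q) :: torus \<times> 'q"
  assume "pin_equivalent e S (pull_back Q)"
  then obtain \<rho> g where hom: "homeomorphic_maps P Q.B \<rho> g" and eq: "pin_equivariant e S Q.PB \<rho>"
    and over: "\<And>z. z \<in> topspace P \<Longrightarrow> pin_xi Q.PB (\<rho> z) = pin_xi S z"
    by (auto simp: pin_equivalent_def pin_diffeo_def simp del: Q.PB_simps)
  have \<rho>: "continuous_map P Q.B \<rho>" and g: "continuous_map Q.B P g"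
    and g\<rho>: "\<And>z. z \<in> topspace P \<Longrightarrow> g (\<rho> z) = z" and \<rho>g: "\<And>w. w \<in> topspace Q.B \<Longrightarrow> \<rho> (g w) = w"
    using hom by (auto simp: homeomorphic_maps_def)
  have t: "continuous_map Q.B Q.B ?t" using Q.homeomorphic_maps_swap by (simp add: homeomorphic_maps_def)
  note lift = Q.is_lift_swap[unfolded is_lift_def]
  have \<rho>B: "\<rho> z \<in> topspace Q.B" if "z \<in> topspace P" for z
    using continuous_map_image_subset_topspace[OF \<rho>] that by blast
  have gP: "g w \<in> topspace P" if "w \<in> topspace Q.B" for w
    using continuous_map_image_subset_topspace[OF g] that by blast
  have tB: "?t w \<in> topspace Q.B" if "w \<in> topspace Q.B" for w
    using continuous_map_image_subset_topspace[OF t] that by blast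
  have actP: "pin_act S z s \<in> topspace P" if "z \<in> topspace P" "s \<in> pin_set e" for z s
    using that pin_set_mult[OF e] by (cases z) auto
  have g_act: "g (pin_act Q.PB w s) = pin_act S (g w) s" if "w \<in> topspace Q.B" "s \<in> pin_set e" for w s
  proof -
    have "\<rho> (pin_act S (g w) s) = pin_act Q.PB w s"
      using eq[unfolded pin_equivariant_def, rule_format, of "g w" s] gP[OF that(1)] that \<rho>g
      by (simp del: Q.PB_simps)
    then show ?thesis using g\<rho>[OF actP[OF gP[OF that(1)] that(2)]] by simp
  qed
  define M where "M = g \<circ> (?t \<circ> \<rho>)"
  have "continuous_map P P M" unfolding M_def by (intro continuous_map_compose[OF _ g] continuous_map_compose[OF \<rho> t])
  moreover have "pin_equivariant e S S M"
    unfolding pin_equivariant_def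
  proof (intro ballI)
    fix z s assume z: "z \<in> topspace (pin_total S)" and s: "s \<in> pin_set e"
    then have zP: "z \<in> topspace P" by simp
    have "\<rho> (pin_act S z s) = pin_act Q.PB (\<rho> z) s" 
      by (rule eq[unfolded pin_equivariant_def, rule_format, OF z s])
    moreover have "?t (pin_act Q.PB (\<rho> z) s) = pin_act Q.PB (?t (\<rho> z)) s"
      using lift \<rho>B[OF zP] s by (simp add: pin_equivariant_def)
    ultimately show "M (pin_act S z s) = pin_act S (M z) s"
      using g_act[OF tB[OF \<rho>B[OF zP]] s] by (simp add: M_def del: Q.PB_simps)
  qed
  moreover have "pin_xi S (M z) = dtau (pin_xi S z)" if "z \<in> topspace P" for z
  proof -
    have "pin_xi S (M z) = pin_xi Q.PB (\<rho> (M z))"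
      using over[of "M z"] gP[OF tB[OF \<rho>B[OF that]]] by (simp add: M_def)
    also have "\<dots> = pin_xi Q.PB (?t (\<rho> z))" using \<rho>g[OF tB[OF \<rho>B[OF that]]] by (simp add: M_def)
    also have "\<dots> = dtau (pin_xi S z)" using lift \<rho>B[OF that] over[OF that] by simp
    finally show ?thesis .
  qed
  ultimately have sq: "M (M z) = (fst z, \<delta> *\<^sub>R snd z)" if "z \<in> UNIV \<times> pin_set e" for z
    by (rule lift_square) (use that in auto)
  define z :: "torus \<times> cl2" where "z = (undefined, cl_one)"
  have z: "z \<in> topspace P" by (simp add: z_def pin_set.one)
  have "\<rho> (M z) = ?t (\<rho> z)" using \<rho>g[OF tB[OF \<rho>B[OF z]]] by (simp add: M_def)
  then have "M (M z) = g (?t (?t (\<rho> z)))" by (simp add: M_def)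
  also have "?t (?t (\<rho> z)) = \<rho> z" by (simp add: case_prod_beta tau_tau)
  finally have "M (M z) = z" using g\<rho>[OF z] by simp
  \<comment> \<open>The two computations of the square disagree at an identity element, because 1
    and - 1 differ in the Clifford algebra.\<close>
  then show False using sq[of z] z \<delta>1 by (auto simp: z_def cl_one_def)
qed

end

section \<open>Quotients by a lift of square one\<close>

text \<open>The final topology carried by the image of f alone, so that the points of a quotient are
  exactly the classes and not all sets of the type.\<close>

definition quotient_topology :: "'a topology \<Rightarrow> ('a \<Rightarrow> 'b) \<Rightarrow> 'b topology" where
  "quotient_topology X f = topology (\<lambda>W. W \<subseteq> f ` topspace X \<and> openin X {x \<in> topspace X. f x \<in> W})"

lemma openin_quotient_topology:
  "openin (quotient_topology X f) W \<longleftrightarrow> W \<subseteq> f ` topspace X \<and> openin X {x \<in> topspace X. f x \<in> W}"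
proof -
  have "istopology (\<lambda>W. W \<subseteq> f ` topspace X \<and> openin X {x \<in> topspace X. f x \<in> W})"
    unfolding istopology_def
  proof (intro conjI allI impI)
    fix S T assume "S \<subseteq> f ` topspace X \<and> openin X {x \<in> topspace X. f x \<in> S}"
      "T \<subseteq> f ` topspace X \<and> openin X {x \<in> topspace X. f x \<in> T}"
    moreover have "{x \<in> topspace X. f x \<in> S \<inter> T} = {x \<in> topspace X. f x \<in> S} \<inter> {x \<in> topspace X. f x \<in> T}"
      by blast
    ultimately show "S \<inter> T \<subseteq> f ` topspace X" "openin X {x \<in> topspace X. f x \<in> S \<inter> T}"
      by (auto simp del: Int_iff)
  next
    fix \<K> assume K: "\<forall>K\<in>\<K>. K \<subseteq> f ` topspace X \<and> openin X {x \<in> topspace X. f x \<in> K}"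
    then show "\<Union>\<K> \<subseteq> f ` topspace X" by blast
    have "{x \<in> topspace X. f x \<in> \<Union>\<K>} = \<Union>((\<lambda>K. {x \<in> topspace X. f x \<in> K}) ` \<K>)" by blast
    then show "openin X {x \<in> topspace X. f x \<in> \<Union>\<K>}" using K by (auto intro: openin_Union)
  qed
  then show ?thesis by (simp add: quotient_topology_def)
qed

lemma topspace_quotient_topology [simp]: "topspace (quotient_topology X f) = f ` topspace X"
proof
  have "{x \<in> topspace X. f x \<in> f ` topspace X} = topspace X" by blast
  then have "openin (quotient_topology X f) (f ` topspace X)" by (simp add: openin_quotient_topology)
  then show "f ` topspace X \<subseteq> topspace (quotient_topology X f)" by (rule openin_subset)
  show "topspace (quotient_topology X f) \<subseteq> f ` topspace X"
    using openin_topspace[of "quotient_topology X f"] by (simp only: openin_quotient_topology)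
qed

lemma quotient_map_quotient_topology: "quotient_map X (quotient_topology X f) f"
  by (simp add: quotient_map_def openin_quotient_topology)

section \<open>The quotient of a twisted structure by its involutive lift\<close>

locale twist_quotient = twist_lift e R q 1 for e R q
begin

definition cls :: "torus \<times> cl2 \<Rightarrow> (torus \<times> cl2) set" where
  "cls z = {z, L z}"

definition neg :: "torus \<times> cl2 \<Rightarrow> torus \<times> cl2" where
  "neg z = pin_act S z (- cl_one)"

text \<open>Points are the L-orbits as sets. Base class and frame class are constant on an orbit in
  the total space, so the images are singletons and \<open>the_elem\<close> reads off their
  value.\<close>

definition Qb :: "((torus \<times> cl2) set, klein, kpair) pin_bundle" where
  "Qb = \<lparr>pin_total = quotient_topology P cls,
     pin_act = (\<lambda>c s. (\<lambda>z. pin_act S z s) ` c),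
     pin_base = (\<lambda>c. the_elem ((\<lambda>z. klein_pi (fst z)) ` c)),
     pin_xi = (\<lambda>c. the_elem ((\<lambda>z. dpi (pin_xi S z)) ` c))\<rparr>"

abbreviation T where "T \<equiv> quotient_topology P cls"

lemma L_L_id: "L (L z) = z"
  using L_L[of "fst z" "snd z"] by simp

lemma fst_L: "fst (L z) = tau (fst z)"
  by (simp add: L_def case_prod_beta)

lemma neg_eq: "neg (x, p) = (x, - p)"
  by (simp add: neg_def)

lemma neg_neg: "neg (neg z) = z"
  by (cases z) (simp add: neg_eq)

lemma L_neg: "L (neg z) = neg (L z)"
  by (simp add: neg_def L_act)

lemma cls_eq_iff: "cls z = cls w \<longleftrightarrow> w = z \<or> w = L z"
  unfolding cls_def doubleton_eq_iff using L_L_id by metis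

lemma Qb_total: "pin_total Qb = T"
  and Qb_act: "pin_act Qb (cls z) s = cls (pin_act S z s)"
  by (simp_all add: Qb_def cls_def L_act)

lemma Qb_base: "pin_base Qb (cls z) = klein_pi (fst z)"
  by (simp add: Qb_def cls_def fst_L)

lemma Qb_xi: "z \<in> topspace P \<Longrightarrow> pin_xi Qb (cls z) = dpi (pin_xi S z)"
  using xi_L[of z] by (simp add: Qb_def cls_def)

lemma quotient_cls: "quotient_map P T cls"
  by (rule quotient_map_quotient_topology)

lemma continuous_L: "continuous_map P P L"
  using homeomorphic_maps_L by (simp add: homeomorphic_maps_def)

lemma continuous_cls: "continuous_map P T cls"
  by (rule quotient_imp_continuous_map[OF quotient_cls])

text \<open>The saturation of U is its union with the preimage under L.\<close>

lemma open_cls: "open_map P T cls"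
  unfolding open_map_def
proof (intro allI impI)
  fix U assume U: "openin P U"
  have US: "U \<subseteq> topspace P" by (rule openin_subset[OF U])
  have "z \<in> topspace P \<Longrightarrow> cls z \<in> cls ` U \<longleftrightarrow> z \<in> U \<or> L z \<in> U" for z
    unfolding image_iff cls_eq_iff by blast
  then have "{z \<in> topspace P. cls z \<in> cls ` U} = U \<union> {z \<in> topspace P. L z \<in> U}"
    using US by blast
  moreover have "openin P (U \<union> {z \<in> topspace P. L z \<in> U})"
    by (intro openin_Un U openin_continuous_map_preimage[OF continuous_L U])
  ultimately show "openin T (cls ` U)"
    using US by (simp add: openin_quotient_topology image_mono)
qed

lemma T_cases:
  assumes "c \<in> topspace T"
  obtains z where "z \<in> topspace P" "c = cls z"
  using assms by auto

lemma xi_eq_neg: "z \<in> topspace P \<Longrightarrow> w \<in> topspace P \<Longrightarrow> pin_xi S z = pin_xi S w \<longleftrightarrow> w = z \<or> w = neg z"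
  using xi_eq_iff[of "snd z" "snd w" "fst z" "fst w"]
  by (cases z; cases w) (auto simp: neg_eq simp del: twisted_pin_simps)

lemma act_closed: "z \<in> topspace P \<Longrightarrow> s \<in> pin_set e \<Longrightarrow> pin_act S z s \<in> topspace P"
  by (cases z) (auto simp: pin_set_mult[OF e])

lemma neg_closed: "z \<in> topspace P \<Longrightarrow> neg z \<in> topspace P"
  unfolding neg_def by (rule act_closed) (auto simp: e pin_set.one)

lemma continuous_neg: "continuous_map P P neg"
proof -
  have "neg = (\<lambda>z. (fst z, - snd z))" by (simp add: fun_eq_iff neg_eq)
  moreover have "continuous_on (UNIV \<times> pin_set e) (\<lambda>z::torus \<times> cl2. (fst z, - snd z))"
    by (intro continuous_intros)
  ultimately show ?thesis using neg_closed by (auto simp: continuous_map_in_subtopology)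
qed

lemma continuous_xi_Qb: "continuous_map T (frames frames_K2) (pin_xi Qb)"
proof (rule continuous_compose_quotient_map[OF quotient_cls])
  have "continuous_map P (frames frames_K2) (dpi \<circ> pin_xi S)"
    by (rule continuous_map_compose[OF continuous_xi continuous_map_dpi])
  then show "continuous_map P (frames frames_K2) (pin_xi Qb \<circ> cls)"
    by (rule continuous_map_eq) (simp add: Qb_xi)
qed

text \<open>Over a frame class lie the four points z, - z, L z, - L z. As L commutes with the sheet
  exchange, they form two orbits, those of z and of - z.\<close>

lemma xi_Qb_eq_iff:
  assumes "z \<in> topspace P" "w \<in> topspace P"
  shows "pin_xi Qb (cls z) = pin_xi Qb (cls w) \<longleftrightarrow> cls w = cls z \<or> cls w = cls (neg z)"
proof -
  have Lz: "L z \<in> topspace P" using L_closed assms(1) by simp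
  have "pin_xi Qb (cls z) = pin_xi Qb (cls w) \<longleftrightarrow> pin_xi S w = pin_xi S z \<or> pin_xi S w = pin_xi S (L z)"
    using assms Qb_xi dpi_eq_iff xi_L[of z] by simp
  also have "\<dots> \<longleftrightarrow> (w = z \<or> w = neg z) \<or> (w = L z \<or> w = neg (L z))"
    using xi_eq_neg[OF assms] xi_eq_neg[OF Lz assms(2)] by metis
  also have "\<dots> \<longleftrightarrow> cls w = cls z \<or> cls w = cls (neg z)"
    using cls_eq_iff[of z w] cls_eq_iff[of "neg z" w] L_neg[of z] by metis
  finally show ?thesis .
qed

lemma open_xi_Qb: "open_map T (frames frames_K2) (pin_xi Qb)"
  unfolding open_map_def
proof (intro allI impI)
  fix U assume U: "openin T U"
  let ?U = "{z \<in> topspace P. cls z \<in> U}"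
  have "cls ` ?U = U" using openin_subset[OF U] by auto
  then have "pin_xi Qb ` U = (\<lambda>z. pin_xi Qb (cls z)) ` ?U" by (metis image_image)
  also have "\<dots> = (dpi \<circ> pin_xi S) ` ?U" by (rule image_cong) (simp_all add: Qb_xi)
  finally have im: "pin_xi Qb ` U = (dpi \<circ> pin_xi S) ` ?U" .
  have "openin P ?U" by (rule openin_continuous_map_preimage[OF continuous_cls U])
  from open_map_compose[OF open_map_xi open_map_dpi, unfolded open_map_def, rule_format, OF this]
  show "openin (frames frames_K2) (pin_xi Qb ` U)" unfolding im .
qed

lemma two_fold_covering_Qb: "two_fold_covering T (frames frames_K2) (pin_xi Qb)"
proof (rule two_fold_coveringI[where \<sigma>="sheet_exchange Qb"])
  show "continuous_map T (frames frames_K2) (pin_xi Qb)" by (rule continuous_xi_Qb)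
  show "open_map T (frames frames_K2) (pin_xi Qb)" by (rule open_xi_Qb)
  have "pin_xi Qb ` topspace T = (\<lambda>z. pin_xi Qb (cls z)) ` topspace P" by (simp add: image_image)
  also have "\<dots> = (\<lambda>z. dpi (pin_xi S z)) ` topspace P" by (rule image_cong) (simp_all add: Qb_xi)
  also have "\<dots> = dpi ` (pin_xi S ` topspace P)" by (rule image_image[symmetric])
  also have "\<dots> = topspace (frames frames_K2)" using xi_image by simp
  finally show "pin_xi Qb ` topspace T = topspace (frames frames_K2)" .
  have se: "sheet_exchange Qb (cls z) = cls (neg z)" for z by (simp add: sheet_exchange_def Qb_act neg_def)
  have se_closed: "sheet_exchange Qb c \<in> topspace T" if c: "c \<in> topspace T" for c
  proof -
    obtain z where z: "z \<in> topspace P" "c = cls z" using c by (rule T_cases)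
    show ?thesis using neg_closed[OF z(1)] by (simp add: se z)
  qed
  have se_se: "sheet_exchange Qb (sheet_exchange Qb c) = c" if c: "c \<in> topspace T" for c
  proof -
    obtain z where z: "z \<in> topspace P" "c = cls z" using c by (rule T_cases)
    show ?thesis by (simp add: se z neg_neg)
  qed
  have cse: "continuous_map T T (sheet_exchange Qb)"
  proof (rule continuous_compose_quotient_map[OF quotient_cls])
    have "continuous_map P T (cls \<circ> neg)" by (rule continuous_map_compose[OF continuous_neg continuous_cls])
    then show "continuous_map P T (sheet_exchange Qb \<circ> cls)"
      by (rule continuous_map_eq) (simp add: se)
  qed
  show "openin T (sheet_exchange Qb ` U)" if U: "openin T U" for U
  proof -
    have US: "U \<subseteq> topspace T" by (rule openin_subset[OF U])
    have "sheet_exchange Qb ` U = {c \<in> topspace T. sheet_exchange Qb c \<in> U}"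
    proof (intro equalityI subsetI)
      fix c assume "c \<in> sheet_exchange Qb ` U"
      then obtain d where d: "d \<in> U" "c = sheet_exchange Qb d" by blast
      have dT: "d \<in> topspace T" using d US by blast
      show "c \<in> {c \<in> topspace T. sheet_exchange Qb c \<in> U}"
        unfolding mem_Collect_eq d(2) se_se[OF dT] using d(1) se_closed[OF dT] by (rule conjI[rotated])
    next
      fix c assume c: "c \<in> {c \<in> topspace T. sheet_exchange Qb c \<in> U}"
      from CollectD[OF c] have cT: "c \<in> topspace T" by (rule conjunct1)
      from CollectD[OF c] have cU: "sheet_exchange Qb c \<in> U" by (rule conjunct2)
      show "c \<in> sheet_exchange Qb ` U"
        by (rule image_eqI[OF _ cU]) (rule se_se[OF cT, symmetric])
    qed
    then show ?thesis using openin_continuous_map_preimage[OF cse U] by simp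
  qed
  show "pin_xi Qb c = pin_xi Qb d \<longleftrightarrow> d = c \<or> d = sheet_exchange Qb c"
    if c: "c \<in> topspace T" and d: "d \<in> topspace T" for c d
  proof -
    obtain z where z: "z \<in> topspace P" "c = cls z" using c by (rule T_cases)
    obtain w where w: "w \<in> topspace P" "d = cls w" using d by (rule T_cases)
    show ?thesis using xi_Qb_eq_iff[OF z(1) w(1)] by (simp add: z(2) w(2) se)
  qed
  show "\<exists>U. openin T U \<and> c \<in> U \<and> disjnt U (sheet_exchange Qb ` U)" if c: "c \<in> topspace T" for c
  proof -
    obtain z where z: "z \<in> topspace P" "c = cls z" using c by (rule T_cases)
    have "snd z \<in> pin_set e" using z by auto
    then obtain H where H: "open H" "snd z \<in> H" "\<And>t. t \<in> H \<Longrightarrow> - t \<notin> H"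
      by (rule pin_half_sphere) blast
    obtain W where W: "open W" "fst z \<in> W" "\<And>y. y \<in> W \<Longrightarrow> tau y \<notin> W" by (rule tau_displaces[of "fst z"]) blast
    \<comment> \<open>A box displaced in both directions: the orbit of - b could meet it at - b
      itself, excluded by H, or at L (- b), excluded by W.\<close>
    let ?N = "(UNIV \<times> pin_set e) \<inter> (W \<times> H)"
    have "openin P ?N" by (intro openin_open_Int open_Times W H)
    then have "openin T (cls ` ?N)" using open_cls by (simp add: open_map_def)
    moreover have "c \<in> cls ` ?N" using z H(2) W(2) by (auto simp: mem_Times_iff simp del: Times_Int_Times)
    moreover have "disjnt (cls ` ?N) (sheet_exchange Qb ` (cls ` ?N))"
      unfolding disjnt_iff
    proof (intro allI notI, elim conjE imageE)
      fix c a d b assume a: "a \<in> ?N" "c = cls a" and b: "b \<in> ?N" "d = cls b" "c = sheet_exchange Qb d"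
      have "fst (neg b) = fst b" "snd (neg b) = - snd b" by (cases b; simp add: neg_eq)+
      moreover have "a = neg b \<or> a = L (neg b)"
        using a b cls_eq_iff[of "neg b" a] by (simp add: se)
      ultimately have "snd a = - snd b \<or> fst a = tau (fst b)" using fst_L[of "neg b"] by metis
      then show False using a(1) b(1) H(3)[of "snd b"] W(3)[of "fst b"] by (auto simp: mem_Times_iff)
    qed
    ultimately show ?thesis by blast
  qed
qed

text \<open>The inverse s of \<open>klein_pi\<close> on a displaced set W transports the product
  structure over W to the quotient.\<close>

lemma local_trivialization_Qb:
  obtains U \<Phi> where "open U" "b \<in> U"
    "homeomorphic_map (prod_topology (top_of_set U) (top_of_set (pin_set e)))
       (subtopology T {p \<in> topspace T. pin_base Qb p \<in> U}) \<Phi>"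
    "\<And>x g. x \<in> U \<Longrightarrow> g \<in> pin_set e \<Longrightarrow> pin_base Qb (\<Phi> (x, g)) = x"
    "\<And>x g h. x \<in> U \<Longrightarrow> g \<in> pin_set e \<Longrightarrow> h \<in> pin_set e \<Longrightarrow> \<Phi> (x, cl_mult e g h) = pin_act Qb (\<Phi> (x, g)) h"
proof -
  obtain x0 where x0: "b = klein_pi x0" by (rule klein_pi_surj)
  obtain W where W: "open W" "x0 \<in> W" "\<And>y. y \<in> W \<Longrightarrow> tau y \<notin> W" by (rule tau_displaces[of x0]) blast
  let ?U = "klein_pi ` W"
  have U: "open ?U" by (rule open_klein_pi_image[OF W(1)])
  have inj: "inj_on klein_pi W"
    by (rule inj_onI) (metis W(3) klein_pi_eq_iff)
  have "homeomorphic_map (top_of_set W) (top_of_set ?U) klein_pi"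
  proof (rule bijective_open_imp_homeomorphic_map)
    show "continuous_map (top_of_set W) (top_of_set ?U) klein_pi"
      using continuous_on_subset[OF continuous_klein_pi] by (auto simp: continuous_map_in_subtopology)
    have "open_map (top_of_set W) euclidean klein_pi"
      unfolding open_map_def using W(1) by (auto simp: openin_open_eq intro: open_klein_pi_image)
    then show "open_map (top_of_set W) (top_of_set ?U) klein_pi" by (rule open_map_into_subtopology) auto
  qed (use inj in auto)
  then obtain s where s: "homeomorphic_maps (top_of_set W) (top_of_set ?U) klein_pi s"
    using homeomorphic_map_maps by blast
  then have sW: "s x \<in> W" "klein_pi (s x) = x" if "x \<in> ?U" for x
    using that by (auto simp: homeomorphic_maps_def)
  have hs: "homeomorphic_map (top_of_set (?U \<times> pin_set e)) (top_of_set (W \<times> pin_set e)) (\<lambda>(x, g). (s x, g))"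
  proof -
    have "homeomorphic_maps (prod_topology (top_of_set ?U) (top_of_set (pin_set e)))
        (prod_topology (top_of_set W) (top_of_set (pin_set e)))
        (\<lambda>(x, g). (s x, id g)) (\<lambda>(x, g). (klein_pi x, id g))"
      using homeomorphic_maps_prod s homeomorphic_maps_sym homeomorphic_maps_id by blast
    then show ?thesis unfolding homeomorphic_map_maps by auto
  qed
  let ?TU = "{p \<in> topspace T. pin_base Qb p \<in> ?U}"
  \<comment> \<open>Every orbit over the image of W has exactly one representative with base point
    in W, so \<open>cls\<close> is bijective there, and it is continuous and open.\<close>
  have hc: "homeomorphic_map (top_of_set (W \<times> pin_set e)) (subtopology T ?TU) cls"
  proof -
    have op: "openin P (W \<times> pin_set e)"
      using openin_open_Int[OF open_Times[OF W(1) open_UNIV], of "UNIV \<times> pin_set e"] by (simp add: Times_Int_Times)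
    have sub: "subtopology P (W \<times> pin_set e) = top_of_set (W \<times> pin_set e)"
      by (simp add: subtopology_subtopology Times_Int_Times)
    have c: "continuous_map (top_of_set (W \<times> pin_set e)) T cls"
      and o: "open_map (top_of_set (W \<times> pin_set e)) T cls"
      using continuous_map_from_subtopology[OF continuous_cls, of "W \<times> pin_set e"]
        open_map_from_subtopology[OF open_cls op] unfolding sub .
    have im: "cls ` (W \<times> pin_set e) = ?TU"
    proof (intro equalityI subsetI)
      fix c assume "c \<in> cls ` (W \<times> pin_set e)"
      then show "c \<in> ?TU" by (auto simp: Qb_base)
    next
      fix c assume "c \<in> ?TU"
      then obtain z where z: "z \<in> topspace P" "c = cls z" "klein_pi (fst z) \<in> ?U" using T_cases Qb_base by force
      then obtain y where "y \<in> W" "klein_pi (fst z) = klein_pi y" by auto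
      then have "fst z \<in> W \<or> fst (L z) \<in> W" using klein_pi_eq_iff[of "fst z" y] fst_L by metis
      moreover have "c = cls (L z)" using z(2) cls_eq_iff[of z "L z"] by blast
      moreover have "L z \<in> UNIV \<times> pin_set e" using L_closed z(1) by simp
      ultimately show "c \<in> cls ` (W \<times> pin_set e)" using z(1,2) by (auto simp: mem_Times_iff)
    qed
    have "inj_on cls (W \<times> pin_set e)"
    proof (rule inj_onI)
      fix z w assume "z \<in> W \<times> pin_set e" "w \<in> W \<times> pin_set e" "cls z = cls w"
      then show "z = w" using cls_eq_iff[of z w] W(3)[of "fst z"] fst_L[of z] by (auto simp: mem_Times_iff)
    qed
    moreover have "continuous_map (top_of_set (W \<times> pin_set e)) (subtopology T ?TU) cls"
      using c im by (auto simp: continuous_map_in_subtopology)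
    moreover have "open_map (top_of_set (W \<times> pin_set e)) (subtopology T ?TU) cls"
      using im by (intro open_map_into_subtopology o) auto
    moreover have "cls ` topspace (top_of_set (W \<times> pin_set e)) = topspace (subtopology T ?TU)"
      using im by auto
    ultimately show ?thesis by (intro bijective_open_imp_homeomorphic_map) auto
  qed
  let ?\<Phi> = "cls \<circ> (\<lambda>(x, g). (s x, g))"
  have "homeomorphic_map (prod_topology (top_of_set ?U) (top_of_set (pin_set e))) (subtopology T ?TU) ?\<Phi>"
    using homeomorphic_map_compose[OF hs hc] by simp
  moreover have "?\<Phi> (x, cl_mult e g h) = pin_act Qb (?\<Phi> (x, g)) h" for x g h
    by (simp add: Qb_act)
  moreover have "pin_base Qb (?\<Phi> (x, g)) = x" if "x \<in> ?U" for x g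
    using sW[OF that] by (simp add: Qb_base)
  ultimately show ?thesis using W(2) U x0 by (intro that[of ?U ?\<Phi>]) auto
qed

lemma principal_bundle_Qb: "principal_bundle (pin_group e) T (pin_act Qb) (pin_base Qb)"
  unfolding principal_bundle_def pin_group_simps
proof (intro conjI)
  let ?G = "top_of_set (pin_set e)"
  let ?c = "\<lambda>(z, g). (cls z, id g)"
  \<comment> \<open>A product of a quotient map with an identity need not be a quotient map; here it
    is one because \<open>cls\<close> is open.\<close>
  have "quotient_map (prod_topology P ?G) (prod_topology T ?G) ?c"
  proof (rule continuous_open_imp_quotient_map)
    show "continuous_map (prod_topology P ?G) (prod_topology T ?G) ?c"
      unfolding continuous_map_prod_top using continuous_cls by simp
    show "open_map (prod_topology P ?G) (prod_topology T ?G) ?c"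
      by (intro open_map_prod open_cls open_map_id)
    show "?c ` topspace (prod_topology P ?G) = topspace (prod_topology T ?G)"
      unfolding topspace_prod_topology image_paired_Times by simp
  qed
  moreover have "continuous_map (prod_topology P ?G) T ((\<lambda>(c, g). pin_act Qb c g) \<circ> ?c)"
    using continuous_map_compose[OF continuous_act continuous_cls]
    by (rule continuous_map_eq) (auto simp: Qb_act)
  ultimately show "continuous_map (prod_topology T ?G) T (\<lambda>(c, g). pin_act Qb c g)"
    by (rule continuous_compose_quotient_map)
  show "continuous_map T euclidean (pin_base Qb)"
  proof (rule continuous_compose_quotient_map[OF quotient_cls])
    have "continuous_map P euclidean (klein_pi \<circ> fst)"
      by (auto simp: o_def intro!: continuous_intros continuous_on_compose2[OF continuous_klein_pi])
    then show "continuous_map P euclidean (pin_base Qb \<circ> cls)"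
      by (rule continuous_map_eq) (simp add: Qb_base)
  qed
  show "\<forall>c\<in>topspace T. pin_act Qb c cl_one = c"
  proof
    fix c assume "c \<in> topspace T"
    then obtain z where "c = cls z" by (rule T_cases)
    then show "pin_act Qb c cl_one = c" by (cases z) (simp add: Qb_act)
  qed
  show "\<forall>c\<in>topspace T. \<forall>g\<in>pin_set e. \<forall>h\<in>pin_set e. pin_act Qb c (cl_mult e g h) = pin_act Qb (pin_act Qb c g) h"
  proof (intro ballI)
    fix c g h assume "c \<in> topspace T"
    then obtain z where "c = cls z" by (rule T_cases)
    then show "pin_act Qb c (cl_mult e g h) = pin_act Qb (pin_act Qb c g) h"
      by (cases z) (simp add: Qb_act cl_mult_assoc[OF e])
  qed
  show "\<forall>c\<in>topspace T. \<forall>g\<in>pin_set e. pin_base Qb (pin_act Qb c g) = pin_base Qb c"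
  proof (intro ballI)
    fix c g assume "c \<in> topspace T"
    then obtain z where "c = cls z" by (rule T_cases)
    then show "pin_base Qb (pin_act Qb c g) = pin_base Qb c"
      by (cases z) (simp add: Qb_act Qb_base)
  qed
  show "\<forall>b. \<exists>U \<Phi>. open U \<and> b \<in> U \<and>
        homeomorphic_map (prod_topology (top_of_set U) ?G) (subtopology T {p \<in> topspace T. pin_base Qb p \<in> U}) \<Phi> \<and>
        (\<forall>x\<in>U. \<forall>g\<in>pin_set e. pin_base Qb (\<Phi> (x, g)) = x) \<and>
        (\<forall>x\<in>U. \<forall>g\<in>pin_set e. \<forall>h\<in>pin_set e. \<Phi> (x, cl_mult e g h) = pin_act Qb (\<Phi> (x, g)) h)"
  proof
    fix b
    show "\<exists>U \<Phi>. open U \<and> b \<in> U \<and>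
        homeomorphic_map (prod_topology (top_of_set U) ?G) (subtopology T {p \<in> topspace T. pin_base Qb p \<in> U}) \<Phi> \<and>
        (\<forall>x\<in>U. \<forall>g\<in>pin_set e. pin_base Qb (\<Phi> (x, g)) = x) \<and>
        (\<forall>x\<in>U. \<forall>g\<in>pin_set e. \<forall>h\<in>pin_set e. \<Phi> (x, cl_mult e g h) = pin_act Qb (\<Phi> (x, g)) h)"
    proof (rule local_trivialization_Qb[of b])
      fix U \<Phi>
      assume *: "open U" "b \<in> U"
        "homeomorphic_map (prod_topology (top_of_set U) (top_of_set (pin_set e)))
          (subtopology T {p \<in> topspace T. pin_base Qb p \<in> U}) \<Phi>"
        "\<And>x g. x \<in> U \<Longrightarrow> g \<in> pin_set e \<Longrightarrow> pin_base Qb (\<Phi> (x, g)) = x"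
        "\<And>x g h. x \<in> U \<Longrightarrow> g \<in> pin_set e \<Longrightarrow> h \<in> pin_set e \<Longrightarrow> \<Phi> (x, cl_mult e g h) = pin_act Qb (\<Phi> (x, g)) h"
      show ?thesis by (intro exI[of _ U] exI[of _ \<Phi>] conjI ballI *)
    qed
  qed
qed

lemma pin_structure_Qb: "pin_structure e frames_K2 Qb"
  unfolding pin_structure_def Qb_total
proof (intro conjI principal_bundle_Qb two_fold_covering_Qb ballI)
  fix c assume "c \<in> topspace T"
  then obtain z where z: "z \<in> topspace P" "c = cls z" by (rule T_cases)
  then show "frame_base frames_K2 (pin_xi Qb c) = pin_base Qb c"
    by (cases z) (simp add: Qb_xi Qb_base)
  fix s assume s: "s \<in> pin_set e"
  have "pin_act S z s \<in> topspace P" by (rule act_closed[OF z(1) s])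
  then show "pin_xi Qb (pin_act Qb c s) = frame_act frames_K2 (pin_xi Qb c) (pin_cover e s)"
    using z s by (cases z) (auto simp: Qb_act Qb_xi pin_cover_mult[OF e] matrix_mul_assoc)
qed

text \<open>An orbit contains exactly one point over each of the two torus points above its base
  class, so base point and orbit together determine z.\<close>

lemma equivalent_pull_back: "pin_equivalent e S (pull_back Qb)"
proof -
  interpret K: klein_pin e Qb by unfold_locales (fact e, fact pin_structure_Qb)
  let ?\<rho> = "\<lambda>z. (fst z, cls z)"
  have \<rho>B: "?\<rho> z \<in> topspace K.B" if "z \<in> topspace P" for z
    using that by (simp add: K.topspace_B Qb_total Qb_base)
  have over: "pin_xi K.PB (?\<rho> z) = pin_xi S z" if z: "z \<in> topspace P" for z
  proof -
    have "pin_xi S z \<in> UNIV \<times> O2" using continuous_map_image_subset_topspace[OF continuous_xi] z by auto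
    moreover have "fst (pin_xi S z) = fst z" by (cases z) simp
    ultimately show ?thesis using frame_at_dpi[of "pin_xi S z"] Qb_xi[OF z] by simp
  qed
  have "bij_betw ?\<rho> (topspace P) (topspace K.B)"
    unfolding bij_betw_def
  proof (intro conjI equalityI subsetI)
    show "inj_on ?\<rho> (topspace P)"
      by (rule inj_onI) (metis Pair_inject cls_eq_iff fst_L tau_neq)
    fix w assume w: "w \<in> topspace K.B"
    obtain x c where xc: "w = (x, c)" by (cases w)
    have "c \<in> topspace T" and b: "klein_pi x = pin_base Qb c"
      using w by (simp_all add: K.topspace_B Qb_total xc)
    from this(1) obtain z where z: "z \<in> topspace P" "c = cls z" by (rule T_cases)
    \<comment> \<open>The two torus points above the base class are the base points of z and L z,
      which gives surjectivity.\<close>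
    have "x = fst z \<or> x = fst (L z)" using b z(2) klein_pi_eq_iff[of "fst z" x] by (simp add: Qb_base fst_L)
    moreover have "c = cls (L z)" using z(2) cls_eq_iff[of z "L z"] by blast
    moreover have "L z \<in> topspace P" using L_closed z(1) by simp
    ultimately show "w \<in> ?\<rho> ` topspace P" using z xc by blast
  qed (use \<rho>B in blast)
  moreover have "continuous_map P K.B ?\<rho>"
    unfolding K.total_PB continuous_map_in_subtopology continuous_map_paired Qb_total
    using continuous_cls by (auto simp: Qb_base intro!: continuous_intros)
  ultimately have "homeomorphic_map P K.B ?\<rho>"
    by (intro homeomorphic_map_over_identity[OF open_map_xi K.two_fold_covering_PB] over)
  then obtain g where "homeomorphic_maps P K.B ?\<rho> g" using homeomorphic_map_maps by blast
  then have "pin_diffeo S K.PB ?\<rho>"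
    using over two_fold_covering_xi K.two_fold_covering_PB
    by (intro pin_diffeo_over[of S K.PB ?\<rho> g id]) (simp_all del: K.PB_simps)
  moreover have "pin_equivariant e S K.PB ?\<rho>"
    unfolding pin_equivariant_def
  proof (intro ballI)
    fix z s
    show "?\<rho> (pin_act S z s) = pin_act K.PB (?\<rho> z) s" by (cases z) (simp add: Qb_act)
  qed
  ultimately show ?thesis unfolding pin_equivalent_def using over by (intro exI[of _ ?\<rho>]) simp
qed

end

section \<open>The four structures\<close>

lemma rot_angle: "rot (angle a) = mat2 (cos a) (- sin a) (sin a) (cos a)"
  by (simp add: rot.abs_eq mat2_def)

lemma orthogonal_rot: "orthogonal_matrix (rot x)"
  by (rule angle_surj[of x]) (simp add: rot_angle orthogonal_matrix2)

text \<open>The source of the sign by which the structures containing R_theta differ from the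
  others.\<close>

lemma rot_plus_pi: "rot (x + angle pi) = - rot x"
  by (rule angle_surj[of x]) (auto simp: plus_angle.abs_eq rot_angle intro!: mat2_eqI)

lemma rot_uminus_j2: "rot (- x) ** j2 = j2 ** rot x"
  by (rule angle_surj[of x])
    (auto simp: uminus_angle.abs_eq rot_angle j2_eq mat2_mult_nth intro!: mat2_eqI)

text \<open>The unit normal of the reflection - j2 R_(2 theta). Its coordinates are taken from
  entries of \<open>rot\<close>, which makes them well defined on angles.\<close>

definition rot_vec :: "torus \<Rightarrow> cl2" where
  "rot_vec = (\<lambda>(\<theta>, \<phi>). (0, rot \<theta> $ 1 $ 1, - rot \<theta> $ 2 $ 1, 0))"

lemma continuous_rot_fst: "continuous_on UNIV (\<lambda>x::torus. rot (fst x))"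
  and continuous_rot_snd: "continuous_on UNIV (\<lambda>x::torus. rot (snd x))"
  by (intro continuous_on_compose2[OF continuous_rot] continuous_intros; simp)+

context
  fixes e :: real
  assumes e: "e = 1 \<or> e = - 1"
begin

lemma e_square: "e * e = 1"
  using e by auto

lemma e2_pin: "(0, 0, 1, 0) \<in> pin_set e"
  by (simp add: pin_set_iff[OF e_square])

lemma pin_cover_e2: "pin_cover e (0, 0, 1, 0) = j2"
  using e2_pin by (simp add: pin_cover_eq[OF e_square] j2_eq)

lemma rot_vec_pin: "rot_vec x \<in> pin_set e"
  by (cases x, rule angle_surj[of "fst x"]) (auto simp: rot_vec_def rot_angle pin_set_iff[OF e_square])

lemma pin_cover_rot_vec: "rot (fst x + angle pi) ** pin_cover e (rot_vec x) = j2 ** rot (fst x)"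
proof -
  obtain a where a: "fst x = angle a" by (rule angle_surj)
  have v: "rot_vec x = (0, cos a, - sin a, 0)" using a by (simp add: rot_vec_def case_prod_beta rot_angle)
  have s: "sin a * sin a + cos a * cos a = 1" using sin_cos_squared_add[of a] by (simp add: power2_eq_square)
  \<comment> \<open>The four entries of the matrix identity, the factor - R_theta already multiplied
    out.\<close>
  have *: "- (cos a) * ((sin a)\<^sup>2 - (cos a)\<^sup>2) + sin a * (2 * cos a * sin a) = cos a"
    "- (cos a) * (2 * cos a * sin a) + sin a * ((cos a)\<^sup>2 - (sin a)\<^sup>2) = - sin a"
    "- sin a * ((sin a)\<^sup>2 - (cos a)\<^sup>2) - cos a * (2 * cos a * sin a) = - sin a"
    "- sin a * (2 * cos a * sin a) - cos a * ((cos a)\<^sup>2 - (sin a)\<^sup>2) = - cos a"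
    using s by algebra+
  show ?thesis
    using rot_vec_pin[of x] unfolding v rot_plus_pi
    by (rule_tac mat2_eqI)
      (use * in \<open>simp_all add: pin_cover_eq[OF e_square] a rot_angle mat2_mult_nth j2_eq mult.assoc\<close>)
qed

text \<open>\<open>tau\<close> reverses the vector, so the product is - v v with v a unit
  vector.\<close>

lemma rot_vec_square: "cl_mult e (rot_vec (tau x)) (rot_vec x) = (- e) *\<^sub>R cl_one"
proof -
  obtain a where a: "fst x = angle a" by (rule angle_surj)
  have "sin a * sin a + cos a * cos a = 1" using sin_cos_squared_add[of a] by (simp add: power2_eq_square)
  then have "e * (cos a * cos a) + e * (sin a * sin a) = e" by algebra
  then show ?thesis
    unfolding rot_vec_def tau_def case_prod_beta fst_conv rot_plus_pi a rot_angle
    by (simp add: cl_one_def cl_mult.simps algebra_simps)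
qed

lemma twist_lift_0: "twist_lift e (\<lambda>(\<theta>, \<phi>). mat 1) (\<lambda>_. (0, 0, 1, 0)) e"
  by unfold_locales
    (use e in \<open>auto simp: case_prod_beta pin_cover_e2 e2_pin cl_one_def cl_mult.simps
      orthogonal_matrix_id\<close>)

lemma twist_lift_1: "twist_lift e (\<lambda>(\<theta>, \<phi>). rot \<theta>) rot_vec (- e)"
proof unfold_locales
  show "continuous_on UNIV rot_vec"
    unfolding rot_vec_def case_prod_beta by (intro continuous_intros continuous_rot_fst)
qed (use e e_square continuous_rot_fst pin_cover_rot_vec rot_vec_square rot_vec_pin orthogonal_rot in
    \<open>auto simp: case_prod_beta tau_def\<close>)

lemma twist_lift_2: "twist_lift e (\<lambda>(\<theta>, \<phi>). rot \<phi>) (\<lambda>_. (0, 0, 1, 0)) e"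
  by unfold_locales
    (use e continuous_rot_snd orthogonal_rot in \<open>auto simp: case_prod_beta pin_cover_e2 e2_pin cl_one_def
      cl_mult.simps tau_def rot_uminus_j2\<close>)

lemma twist_lift_3: "twist_lift e (\<lambda>(\<theta>, \<phi>). rot \<phi> ** rot \<theta>) rot_vec (- e)"
proof -
  interpret t: twist_lift e "\<lambda>(\<theta>, \<phi>). rot \<theta>" rot_vec "- e" by (rule twist_lift_1)
  show ?thesis
  proof unfold_locales
    show "continuous_on UNIV (\<lambda>(\<theta>, \<phi>). rot \<phi> ** rot \<theta>)"
      unfolding case_prod_beta by (intro continuous_intros continuous_rot_fst continuous_rot_snd)
    fix x :: torus
    \<comment> \<open>The identity for theta alone is applied first; then R_(-phi) passes across
      \<open>j2\<close> and becomes R_phi.\<close>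
    have "rot (- snd x) ** (rot (fst x + angle pi) ** pin_cover e (rot_vec x)) = j2 ** rot (snd x) ** rot (fst x)"
      by (simp add: pin_cover_rot_vec matrix_mul_assoc rot_uminus_j2)
    then show "(case tau x of (\<theta>, \<phi>) \<Rightarrow> rot \<phi> ** rot \<theta>) ** pin_cover e (rot_vec x)
        = j2 ** (case x of (\<theta>, \<phi>) \<Rightarrow> rot \<phi> ** rot \<theta>)"
      by (simp add: tau_def case_prod_beta matrix_mul_assoc)
  qed (use e orthogonal_rot t.continuous_q rot_vec_square rot_vec_pin in
      \<open>auto simp: case_prod_beta orthogonal_matrix_mul\<close>)
qed

text \<open>The squares e and - e, evaluated at both signs of \<open>e\<close>, give the whole table
  of lifts.\<close>

lemma xi_twist_lift:
  shows "S \<in> {xi0 e, xi2 e} \<Longrightarrow> \<exists>R q. S = twisted_pin e R \<and> twist_lift e R q e"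
    and "S \<in> {xi1 e, xi3 e} \<Longrightarrow> \<exists>R q. S = twisted_pin e R \<and> twist_lift e R q (- e)"
  using twist_lift_0 twist_lift_1 twist_lift_2 twist_lift_3
  by (auto simp: xi0_def xi1_def xi2_def xi3_def)

lemma xi_tau_invariant:
  assumes "S \<in> {xi0 e, xi1 e, xi2 e, xi3 e}"
  shows "pin_structure e frames_T2 S \<and> tau_invariant e S"
proof -
  obtain R q \<delta> where S: "S = twisted_pin e R" and "twist_lift e R q \<delta>"
    using assms xi_twist_lift[of S] by blast
  interpret twist_lift e R q \<delta> by fact
  show ?thesis using pin_structure_twisted is_lift_L unfolding S tau_invariant_def by blast
qed

text \<open>Shows that the pull-back map takes values in the invariant structures, so that its
  surjectivity onto them is a meaningful question.\<close>

lemma pull_back_tau_invariant: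
  assumes "pin_structure e frames_K2 Q"
  shows "pin_structure e frames_T2 (pull_back Q) \<and> tau_invariant e (pull_back Q)"
proof -
  interpret klein_pin e Q by unfold_locales (fact e_square, fact assms)
  show ?thesis using pin_structure_PB is_lift_swap unfolding tau_invariant_def by blast
qed

end

section \<open>Consequences of the square of the lifts\<close>

lemma lift_square_id:
  assumes "\<exists>R q. S = twisted_pin e R \<and> twist_lift e R q 1"
  shows "\<forall>L. is_lift e dtau S L \<longrightarrow> squares_to_id S L"
    and "\<exists>Q :: ((torus \<times> cl2) set, klein, kpair) pin_bundle.
       pin_structure e frames_K2 Q \<and> pin_equivalent e S (pull_back Q)"
proof -
  obtain R q where S: "S = twisted_pin e R" and "twist_lift e R q 1" using assms by blast
  interpret twist_lift e R q 1 by fact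
  interpret twist_quotient e R q by unfold_locales
  show "\<forall>L. is_lift e dtau S L \<longrightarrow> squares_to_id S L" using lift_squares(1) S by blast
  show "\<exists>Q :: ((torus \<times> cl2) set, klein, kpair) pin_bundle.
       pin_structure e frames_K2 Q \<and> pin_equivalent e S (pull_back Q)"
    using pin_structure_Qb equivalent_pull_back S by blast
qed

lemma lift_square_exchange:
  assumes "\<exists>R q. S = twisted_pin e R \<and> twist_lift e R q (- 1)"
  shows "\<forall>L. is_lift e dtau S L \<longrightarrow> squares_to_exchange S L"
    and "\<nexists>Q :: ('q, klein, kpair) pin_bundle.
       pin_structure e frames_K2 Q \<and> pin_equivalent e S (pull_back Q)"
proof -
  obtain R q where S: "S = twisted_pin e R" and "twist_lift e R q (- 1)" using assms by blast
  interpret twist_lift e R q "- 1" by fact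
  show "\<forall>L. is_lift e dtau S L \<longrightarrow> squares_to_exchange S L" using lift_squares(2) S by blast
  show "\<nexists>Q :: ('q, klein, kpair) pin_bundle.
       pin_structure e frames_K2 Q \<and> pin_equivalent e S (pull_back Q)"
    using not_equivalent_pull_back S by blast
qed

(* The free type variable 'q is the type of points of an arbitrary pin bundle on the Klein
   bottle; existence is asserted at a fixed type, non-existence at every type. *)

theorem mainTheorem2:
  shows
    "(\<forall>e\<in>{1, - 1}. \<forall>S\<in>{xi0 e, xi1 e, xi2 e, xi3 e}.
        pin_structure e frames_T2 S \<and> tau_invariant e S)
   \<and> (\<forall>S\<in>{xi0 1, xi2 1}. \<forall>L. is_lift 1 dtau S L \<longrightarrow> squares_to_id S L)
   \<and> (\<forall>S\<in>{xi0 (- 1), xi2 (- 1)}. \<forall>L. is_lift (- 1) dtau S L \<longrightarrow> squares_to_exchange S L)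
   \<and> (\<forall>S\<in>{xi1 1, xi3 1}. \<forall>L. is_lift 1 dtau S L \<longrightarrow> squares_to_exchange S L)
   \<and> (\<forall>S\<in>{xi1 (- 1), xi3 (- 1)}. \<forall>L. is_lift (- 1) dtau S L \<longrightarrow> squares_to_id S L)
   \<and> (\<forall>S\<in>{xi0 1, xi2 1}. \<exists>Q :: ((torus \<times> cl2) set, klein, kpair) pin_bundle.
        pin_structure 1 frames_K2 Q \<and> pin_equivalent 1 S (pull_back Q))
   \<and> (\<forall>S\<in>{xi1 1, xi3 1}. \<nexists>Q :: ('q, klein, kpair) pin_bundle.
        pin_structure 1 frames_K2 Q \<and> pin_equivalent 1 S (pull_back Q))
   \<and> (\<forall>S\<in>{xi1 (- 1), xi3 (- 1)}. \<exists>Q :: ((torus \<times> cl2) set, klein, kpair) pin_bundle.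
        pin_structure (- 1) frames_K2 Q \<and> pin_equivalent (- 1) S (pull_back Q))
   \<and> (\<forall>S\<in>{xi0 (- 1), xi2 (- 1)}. \<nexists>Q :: ('q, klein, kpair) pin_bundle.
        pin_structure (- 1) frames_K2 Q \<and> pin_equivalent (- 1) S (pull_back Q))
   \<and> (\<forall>e\<in>{1, - 1}. \<forall>Q :: ('q, klein, kpair) pin_bundle. pin_structure e frames_K2 Q \<longrightarrow>
        pin_structure e frames_T2 (pull_back Q) \<and> tau_invariant e (pull_back Q))
   \<and> (\<forall>e\<in>{1, - 1}. \<not> (\<forall>S :: (torus \<times> cl2, torus, tpair) pin_bundle.
        pin_structure e frames_T2 S \<and> tau_invariant e S \<longrightarrow>
        (\<exists>Q :: ('q, klein, kpair) pin_bundle.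
           pin_structure e frames_K2 Q \<and> pin_equivalent e S (pull_back Q))))"
proof -
  have id_1: "\<exists>R q. S = twisted_pin 1 R \<and> twist_lift 1 R q 1" if "S \<in> {xi0 1, xi2 1}" for S
    using xi_twist_lift(1)[of 1 S] that by simp
  have id_m1: "\<exists>R q. S = twisted_pin (- 1) R \<and> twist_lift (- 1) R q 1" if "S \<in> {xi1 (- 1), xi3 (- 1)}" for S
    using xi_twist_lift(2)[of "- 1" S] that by simp
  have ex_1: "\<exists>R q. S = twisted_pin 1 R \<and> twist_lift 1 R q (- 1)" if "S \<in> {xi1 1, xi3 1}" for S
    using xi_twist_lift(2)[of 1 S] that by simp
  have ex_m1: "\<exists>R q. S = twisted_pin (- 1) R \<and> twist_lift (- 1) R q (- 1)" if "S \<in> {xi0 (- 1), xi2 (- 1)}" for S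
    using xi_twist_lift(1)[of "- 1" S] that by simp
  have inv: "pin_structure e frames_T2 S \<and> tau_invariant e S"
    if "e \<in> {1, - 1}" "S \<in> {xi0 e, xi1 e, xi2 e, xi3 e}" for e S
    using that by (intro xi_tau_invariant) auto
  show ?thesis
  proof (intro conjI ballI)
    show "pin_structure e frames_T2 S" "tau_invariant e S"
      if "e \<in> {1, - 1}" "S \<in> {xi0 e, xi1 e, xi2 e, xi3 e}" for e S
      using inv[OF that] by blast+
    show "\<forall>Q :: ('q, klein, kpair) pin_bundle. pin_structure e frames_K2 Q \<longrightarrow>
        pin_structure e frames_T2 (pull_back Q) \<and> tau_invariant e (pull_back Q)"
      if "e \<in> {1, - 1}" for e
      using that by (intro allI impI pull_back_tau_invariant) auto
    show "\<not> (\<forall>S :: (torus \<times> cl2, torus, tpair) pin_bundle.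
        pin_structure e frames_T2 S \<and> tau_invariant e S \<longrightarrow>
        (\<exists>Q :: ('q, klein, kpair) pin_bundle.
           pin_structure e frames_K2 Q \<and> pin_equivalent e S (pull_back Q)))"
      if e: "e \<in> {1, - 1}" for e
    \<comment> \<open>For either sign the witness is an invariant structure whose lifts square to
      the sheet exchange: \<open>xi1\<close> for pin-plus, \<open>xi0\<close> for pin-minus.\<close>
    proof (cases "e = 1")
      case True
      then show ?thesis
        using inv[of 1 "xi1 1"] lift_square_exchange(2)[OF ex_1[of "xi1 1"]] by blast
    next
      case False
      then have "e = - 1" using e by blast
      then show ?thesis
        using inv[of "- 1" "xi0 (- 1)"] lift_square_exchange(2)[OF ex_m1[of "xi0 (- 1)"]] by blast
    qed
  qed (rule lift_square_id lift_square_exchange, erule id_1 id_m1 ex_1 ex_m1)+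
qed

end
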